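(* The quantitative emptiness problem for PosLimInf and the quantitative universality problem for AsLimSup are decidable. That is, there is an algorithm that, given a probabilistic weighted automaton $A$ over $\Sigma$ (with rational data) and a rational $\nu$, decides whether there exists $w\in\Sigma^\omega$ with $L^{>0}_A(w)\ge\nu$ where the value function is $\mathsf{LimInf}$; and there is an algorithm that, given such $A$ and $\nu$, decides whether $L^{=1}_A(w)\ge\nu$ for all $w\in\Sigma^\omega$ where the value function is $\mathsf{LimSup}$.
   Context: A probabilistic weighted automaton over a finite alphabet $\Sigma$ is a tuple $A=(Q,\rho_I,\Sigma,\delta,\gamma)$ where $Q$ is a finite set of states, $\rho_I$ is a probability distribution on $Q$, $\delta:Q\times\Sigma\to\mathcal D(Q)$ assigns to each state and letter a probability distribution on $Q$, and $\gamma:Q\times\Sigma\times Q\to\mathbb Q$ is a weight function. A run over an infinite word $w=\sigma_1\sigma_2\dots$ is a sequence $r=q_0\sigma_1q_1\sigma_2\dots$ with $\rho_I(q_0)>0$ and $\delta(q_i,\sigma_{i+1})(q_{i+1})>0$ for all $i$; its weight sequence is $\gamma(r)=v_0v_1\dots$ with $v_i=\gamma(q_i,\sigma_{i+1},q_{i+1})$. For each $w$, the probabilities of finite run prefixes $\rho_I(q_0)\prod_{i=1}^k\delta(q_{i-1},\sigma_i)(q_i)$ induce a probability measure $\mathbb P^A$ on runs over $w$. For a value function $\mathrm{Val}$, $L^{>0}_A(w)=\sup\{\eta\mid \mathbb P^A(\{r:\mathrm{Val}(\gamma(r))\ge\eta\})>0\}$ (positive semantics) and $L^{=1}_A(w)=\sup\{\eta\mid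 \mathbb P^A(\{r:\mathrm{Val}(\gamma(r))\ge\eta\})=1\}$ (almost-sure semantics). $\mathsf{LimInf}(v)=\liminf_n v_n$, $\mathsf{LimSup}(v)=\limsup_n v_n$. PosLimInf is the class of $\mathsf{LimInf}$-automata under positive semantics; AsLimSup is the class of $\mathsf{LimSup}$-automata under almost-sure semantics. *)

theory Defs
  imports "HOL-Probability.Probability" "HOL-Library.Nat_Bijection"
begin

datatype recf = Zero | Succ | Proj nat | Comp recf "recf list" | Prec recf recf | Mn recf

inductive eval_recf :: "recf \<Rightarrow> nat list \<Rightarrow> nat \<Rightarrow> bool" where
  zero: "eval_recf Zero xs 0"
| succ: "eval_recf Succ (x # xs) (Suc x)"
| proj: "i < length xs \<Longrightarrow> eval_recf (Proj i) xs (xs ! i)"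
| comp: "list_all2 (\<lambda>g y. eval_recf g xs y) gs ys \<Longrightarrow> eval_recf f ys z
          \<Longrightarrow> eval_recf (Comp f gs) xs z"
| prec0: "eval_recf f xs y \<Longrightarrow> eval_recf (Prec f g) (0 # xs) y"
| precS: "eval_recf (Prec f g) (n # xs) y \<Longrightarrow> eval_recf g (n # y # xs) z
          \<Longrightarrow> eval_recf (Prec f g) (Suc n # xs) z"
| mn: "eval_recf f (n # xs) 0 \<Longrightarrow> (\<forall>k<n. \<exists>y. eval_recf f (k # xs) (Suc y))
          \<Longrightarrow> eval_recf (Mn f) xs n"
monos list_all2_mono

definition decidable_on :: "('a \<Rightarrow> nat) \<Rightarrow> ('a \<Rightarrow> bool) \<Rightarrow> ('a \<Rightarrow> bool) \<Rightarrow> bool" where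
  "decidable_on enc valid P \<longleftrightarrow>
     (\<exists>f. \<forall>x. valid x \<longrightarrow> eval_recf f [enc x] (if P x then 1 else 0))"

text \<open>States are 0..<n, letters are 0..<m.  init ! q = rho_I(q),
  trans ! q ! a ! q' = delta(q,a)(q'),  wt ! q ! a ! q' = gamma(q,a,q').\<close>
datatype pwa = PWA (nstates: nat) (nletters: nat) (init: "rat list")
                   (trans: "rat list list list") (wt: "rat list list list")

definition distr_list :: "nat \<Rightarrow> rat list \<Rightarrow> bool" where
  "distr_list n xs \<longleftrightarrow> length xs = n \<and> (\<forall>x\<in>set xs. 0 \<le> x) \<and> sum_list xs = 1"

definition wf_pwa :: "pwa \<Rightarrow> bool" where
  "wf_pwa A \<longleftrightarrow>
     distr_list (nstates A) (init A) \<and>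
     length (trans A) = nstates A \<and>
     (\<forall>q<nstates A. length (trans A ! q) = nletters A \<and>
        (\<forall>a<nletters A. distr_list (nstates A) (trans A ! q ! a))) \<and>
     length (wt A) = nstates A \<and>
     (\<forall>q<nstates A. length (wt A ! q) = nletters A \<and>
        (\<forall>a<nletters A. length (wt A ! q ! a) = nstates A))"

definition rhoI :: "pwa \<Rightarrow> nat \<Rightarrow> real" where
  "rhoI A q = (if q < nstates A then real_of_rat (init A ! q) else 0)"

definition delta :: "pwa \<Rightarrow> nat \<Rightarrow> nat \<Rightarrow> nat \<Rightarrow> real" where
  "delta A q a q' = (if q < nstates A \<and> a < nletters A \<and> q' < nstates A
      then real_of_rat (trans A ! q ! a ! q') else 0)"

definition gamma :: "pwa \<Rightarrow> nat \<Rightarrow> nat \<Rightarrow> nat \<Rightarrow> real" where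
  "gamma A q a q' = (if q < nstates A \<and> a < nletters A \<and> q' < nstates A
      then real_of_rat (wt A ! q ! a ! q') else 0)"

definition words :: "pwa \<Rightarrow> (nat \<Rightarrow> nat) set" where
  "words A = {w. \<forall>i. w i < nletters A}"

text \<open>Runs are represented by their state sequences q0 q1 q2 ... (the letters are those of w).\<close>
definition run_space :: "(nat \<Rightarrow> nat) measure" where
  "run_space = PiM UNIV (\<lambda>_. count_space UNIV)"

definition prefix_prob :: "pwa \<Rightarrow> (nat \<Rightarrow> nat) \<Rightarrow> nat list \<Rightarrow> real" where
  "prefix_prob A w qs =
     rhoI A (qs ! 0) * (\<Prod>i\<in>{1..<length qs}. delta A (qs ! (i - 1)) (w (i - 1)) (qs ! i))"

definition cylinder :: "nat list \<Rightarrow> (nat \<Rightarrow> nat) set" where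
  "cylinder qs = {r \<in> space run_space. \<forall>i<length qs. r i = qs ! i}"

definition run_measure :: "pwa \<Rightarrow> (nat \<Rightarrow> nat) \<Rightarrow> (nat \<Rightarrow> nat) measure" where
  "run_measure A w = (THE M. sets M = sets run_space \<and> prob_space M \<and>
      (\<forall>qs. qs \<noteq> [] \<longrightarrow> emeasure M (cylinder qs) = ennreal (prefix_prob A w qs)))"

definition weight_seq :: "pwa \<Rightarrow> (nat \<Rightarrow> nat) \<Rightarrow> (nat \<Rightarrow> nat) \<Rightarrow> nat \<Rightarrow> real" where
  "weight_seq A w r i = gamma A (r i) (w i) (r (Suc i))"

definition LimInf :: "(nat \<Rightarrow> real) \<Rightarrow> ereal" where
  "LimInf v = liminf (\<lambda>n. ereal (v n))"

definition LimSup :: "(nat \<Rightarrow> real) \<Rightarrow> ereal" where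
  "LimSup v = limsup (\<lambda>n. ereal (v n))"

definition L_pos :: "((nat \<Rightarrow> real) \<Rightarrow> ereal) \<Rightarrow> pwa \<Rightarrow> (nat \<Rightarrow> nat) \<Rightarrow> ereal" where
  "L_pos Val A w = Sup (ereal ` {\<eta>::real.
      emeasure (run_measure A w) {r \<in> space run_space. Val (weight_seq A w r) \<ge> ereal \<eta>} > 0})"

definition L_as :: "((nat \<Rightarrow> real) \<Rightarrow> ereal) \<Rightarrow> pwa \<Rightarrow> (nat \<Rightarrow> nat) \<Rightarrow> ereal" where
  "L_as Val A w = Sup (ereal ` {\<eta>::real.
      emeasure (run_measure A w) {r \<in> space run_space. Val (weight_seq A w r) \<ge> ereal \<eta>} = 1})"

definition enc_rat :: "rat \<Rightarrow> nat" where
  "enc_rat q = (case quotient_of q of (a, b) \<Rightarrow> prod_encode (int_encode a, int_encode b))"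

definition enc_list :: "('a \<Rightarrow> nat) \<Rightarrow> 'a list \<Rightarrow> nat" where
  "enc_list e xs = list_encode (map e xs)"

definition enc_pwa :: "pwa \<Rightarrow> nat" where
  "enc_pwa A = list_encode [nstates A, nletters A, enc_list enc_rat (init A),
      enc_list (enc_list (enc_list enc_rat)) (trans A),
      enc_list (enc_list (enc_list enc_rat)) (wt A)]"

definition enc_inst :: "pwa \<times> rat \<Rightarrow> nat" where
  "enc_inst x = prod_encode (enc_pwa (fst x), enc_rat (snd x))"

end

theory Submission
  imports Defs
begin

text \<open>
  The weights take finitely many values, so \<open>LimInf \<ge> \<nu>\<close> means that eventually all weights are
  \<open>\<ge> \<nu>\<close>, and \<open>LimSup \<ge> \<nu>\<close> fails iff eventually all weights are \<open>< \<nu>\<close>. Both problems thus ask whether some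
  word makes the transitions eventually good with positive probability.

  If every word of length \<open>N = 2\<^sup>n\<close> can hit a bad transition from every reachable state, it does so with
  probability at least \<open>e\<^sup>N\<close>, where \<open>e\<close> is the least positive transition probability; the probability of
  surviving \<open>k\<close> such blocks then decays like \<open>(1 - e\<^sup>N)\<^sup>k\<close>, so eventual goodness is a null event. Otherwise
  some word of length \<open>N\<close> is surely good from a reachable state \<open>q\<close>; among the \<open>N + 1\<close> supports that it
  visits two coincide, and looping between them stays good forever. So the question is whether there is a
  family of supports, containing \<open>{q}\<close> for a reachable \<open>q\<close>, in which some letter always stays surely good.
  This is a bounded first-order statement about bit sets, hence primitive recursive.
\<close>

section \<open>Primitive recursive expressions\<close>

text \<open>Variables are de Bruijn indices; \<open>Rec\<close> binds the counter (index 0) and the previous value (index 1).\<close>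
datatype pexp = Var nat | Nul | Inc pexp | Call pexp "pexp list" | Rec pexp pexp pexp
  | BEx pexp pexp

text \<open>A missing variable reads as 0, which makes evaluation total. A called expression sees
  only its arguments, so it can be placed under any binders without renumbering.\<close>

fun ev :: "pexp \<Rightarrow> nat list \<Rightarrow> nat" where
  "ev (Var i) xs = (if i < length xs then xs ! i else 0)"
| "ev Nul xs = 0"
| "ev (Inc e) xs = Suc (ev e xs)"
| "ev (Call e es) xs = ev e (map (\<lambda>e'. ev e' xs) es)"
| "ev (Rec z s n) xs = rec_nat (ev z xs) (\<lambda>i y. ev s (i # y # xs)) (ev n xs)"
| "ev (BEx n p) xs = (if \<exists>i<ev n xs. ev p (i # xs) \<noteq> 0 then 1 else 0)"

lemma eval_recf_Prec:
  assumes "eval_recf f xs z" "\<And>i y. eval_recf g (i # y # xs) (s i y)"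
  shows "eval_recf (Prec f g) (n # xs) (rec_nat z s n)"
  using assms by (induction n) (auto intro: eval_recf.intros)

lemma eval_recf_Comp:
  assumes "length gs = length ys" "\<And>i. i < length ys \<Longrightarrow> eval_recf (gs ! i) xs (ys ! i)"
    and "eval_recf f ys z"
  shows "eval_recf (Comp f gs) xs z"
  using assms by (intro eval_recf.comp[of _ _ ys]) (auto simp: list_all2_conv_all_nth)

text \<open>The arity is fixed because the translation must know how many environment entries to
  pass on by projections.\<close>

definition computes :: "nat \<Rightarrow> recf \<Rightarrow> (nat list \<Rightarrow> nat) \<Rightarrow> bool" where
  "computes k f F \<longleftrightarrow> (\<forall>xs. length xs = k \<longrightarrow> eval_recf f xs (F xs))"

text \<open>Recursive functions have no environment: the new values \<open>pre xs\<close> go in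
  front, and the entries of \<open>xs\<close> after the first \<open>j\<close> are handed over by
  projections.\<close>

lemma computes_Comp_rest:
  assumes "computes (length (pre xs) + k) f F" "length xs = j + k"
    and "length gs = length (pre xs)"
    and "\<And>i. i < length gs \<Longrightarrow> eval_recf (gs ! i) xs (pre xs ! i)"
  shows "eval_recf (Comp f (gs @ map Proj [j..<j + k])) xs (F (pre xs @ drop j xs))"
proof (rule eval_recf_Comp)
  show "eval_recf f (pre xs @ drop j xs) (F (pre xs @ drop j xs))"
    using assms(1,2) by (simp add: computes_def)
  show "eval_recf ((gs @ map Proj [j..<j + k]) ! i) xs ((pre xs @ drop j xs) ! i)"
    if "i < length (pre xs @ drop j xs)" for i
  proof (cases "i < length gs")
    case True
    then show ?thesis using assms(3,4) by (simp add: nth_append)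
  next
    case False
    have "j + (i - length gs) < length xs" using that False assms(2,3) by auto
    from eval_recf.proj[OF this] show ?thesis
      using that False assms(2,3) by (simp add: nth_append)
  qed
qed (use assms in simp)

text \<open>Bounded search is primitive recursion on the bound, carrying a 0/1 flag that records
  whether a witness was found.\<close>

lemma computes_BEx:
  assumes "computes k fn N" "computes (Suc k) fp P"
  shows "\<exists>f. computes k f (\<lambda>xs. if \<exists>i<N xs. P (i # xs) \<noteq> 0 then 1 else 0)"
proof -
  define one where "one = Comp Succ [Zero]"
  have one: "eval_recf one xs 1" for xs
    unfolding one_def
    by (rule eval_recf_Comp[where ys = "[0]"]) (auto intro: eval_recf.intros)
  define s where "s i y xs = (if (y::nat) = 0 then if P (i # xs) = 0 then 0 else 1 else (1::nat))" for i y xs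
  define sg where "sg = Comp (Prec Zero one) [fp]"
  have sg: "eval_recf sg (i # xs) (if P (i # xs) = 0 then 0 else 1)" if "length xs = k" for i xs
    unfolding sg_def
  proof (rule eval_recf_Comp[where ys = "[P (i # xs)]"])
    have "eval_recf (Prec Zero one) [P (i # xs)] (rec_nat 0 (\<lambda>_ _. 1) (P (i # xs)))"
      by (rule eval_recf_Prec) (auto intro: eval_recf.zero one[simplified])
    also have "rec_nat 0 (\<lambda>_ _. 1) (P (i # xs)) = (if P (i # xs) = 0 then 0 else (1::nat))"
      by (cases "P (i # xs)") auto
    finally show "eval_recf (Prec Zero one) [P (i # xs)] (if P (i # xs) = 0 then 0 else 1)" .
  qed (use assms(2) that in \<open>auto simp: computes_def\<close>)
  \<comment> \<open>The case distinction on the flag \<open>y\<close> is again a recursion, so the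
    flag moves to the front: at \<open>y = 0\<close> the test \<open>sg\<close> runs on
    \<open>i # xs\<close>, otherwise the result stays 1.\<close>
  define g where "g = Comp (Prec sg one) ([Proj 1, Proj 0] @ map Proj [2..<2 + k])"
  have g: "eval_recf g (i # y # xs) (s i y xs)" if "length xs = k" for i y xs
  proof -
    have 1: "computes (length [y, i] + k) (Prec sg one)
        (\<lambda>ys. rec_nat (if P (tl ys) = 0 then 0 else 1) (\<lambda>_ _. 1) (hd ys))"
      unfolding computes_def
    proof safe
      fix zs :: "nat list" assume "length zs = length [y, i] + k"
      then obtain a b cs where zs: "zs = a # b # cs" and cs: "length cs = k"
        by (auto simp: length_Suc_conv)
      show "eval_recf (Prec sg one) zs
          (rec_nat (if P (tl zs) = 0 then 0 else 1) (\<lambda>_ _. 1) (hd zs))"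
        unfolding zs list.sel by (rule eval_recf_Prec[OF sg[OF cs] one])
    qed
    have "eval_recf g (i # y # xs)
      ((\<lambda>ys. rec_nat (if P (tl ys) = 0 then 0 else 1) (\<lambda>_ _. 1) (hd ys))
         ([y, i] @ drop 2 (i # y # xs)))"
      unfolding g_def
      by (rule computes_Comp_rest[where pre = "\<lambda>_. [y, i]", OF 1])
        (use that eval_recf.proj[of 0 "i # y # xs"] eval_recf.proj[of 1 "i # y # xs", simplified]
          in \<open>auto simp: less_Suc_eq\<close>)
    then show ?thesis by (cases y) (simp_all add: s_def)
  qed
  define h where "h = Comp (Prec Zero g) ([fn] @ map Proj [0..<0 + k])"
  have rec: "rec_nat 0 (\<lambda>i y. s i y xs) n = (if \<exists>i<n. P (i # xs) \<noteq> 0 then 1 else 0)" for n xs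
    by (induction n) (auto simp: s_def less_Suc_eq)
  have "computes k h (\<lambda>xs. if \<exists>i<N xs. P (i # xs) \<noteq> 0 then 1 else 0)"
    unfolding computes_def
  proof safe
    fix xs :: "nat list" assume len: "k = length xs"
    have 1: "computes (length [N xs] + k) (Prec Zero g)
        (\<lambda>ys. rec_nat 0 (\<lambda>i y. s i y (tl ys)) (hd ys))"
      unfolding computes_def
    proof safe
      fix zs :: "nat list" assume "length zs = length [N xs] + k"
      then obtain a cs where zs: "zs = a # cs" and cs: "length cs = k"
        by (auto simp: length_Suc_conv)
      show "eval_recf (Prec Zero g) zs (rec_nat 0 (\<lambda>i y. s i y (tl zs)) (hd zs))"
        unfolding zs list.sel by (rule eval_recf_Prec) (auto intro: g[OF cs] eval_recf.zero)
    qed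
    have "eval_recf h xs ((\<lambda>ys. rec_nat 0 (\<lambda>i y. s i y (tl ys)) (hd ys)) ([N xs] @ drop 0 xs))"
      unfolding h_def
      by (rule computes_Comp_rest[where pre = "\<lambda>_. [N xs]", OF 1])
        (use assms(1) len in \<open>auto simp: computes_def\<close>)
    then show "eval_recf h xs (if \<exists>i<N xs. P (i # xs) \<noteq> 0 then 1 else 0)"
      by (simp add: rec)
  qed
  then show ?thesis by blast
qed

text \<open>Structural induction; the arity stays arbitrary because \<open>Rec\<close> and
  \<open>BEx\<close> enlarge the environment of their bodies.\<close>

lemma ev_computable: "\<exists>f. computes k f (ev e)"
proof (induction e arbitrary: k)
  case (Var i)
  have "computes k (if i < k then Proj i else Zero) (ev (Var i))"
    by (auto simp: computes_def intro: eval_recf.intros)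
  then show ?case by blast
next
  case Nul
  have "computes k Zero (ev Nul)" by (auto simp: computes_def intro: eval_recf.intros)
  then show ?case by blast
next
  case (Inc e)
  then obtain f where "computes k f (ev e)" by blast
  then have "computes k (Comp Succ [f]) (ev (Inc e))"
    by (auto simp: computes_def intro!: eval_recf_Comp[where ys = "[_]"] eval_recf.succ)
  then show ?case by blast
next
  case (Call e es)
  obtain f where f: "computes (length es) f (ev e)" using Call.IH(1) by blast
  have "\<forall>e\<in>set es. \<exists>f. computes k f (ev e)" using Call.IH(2) by blast
  then obtain F where F: "\<And>e. e \<in> set es \<Longrightarrow> computes k (F e) (ev e)" by metis
  have "computes k (Comp f (map F es)) (ev (Call e es))"
    unfolding computes_def
    by (auto intro!: eval_recf_Comp[where ys = "map (\<lambda>e'. ev e' _) es"] F[unfolded computes_def, rule_format]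
        f[unfolded computes_def, rule_format])
  then show ?case by blast
next
  case (Rec z s n)
  obtain fz fs fn where f: "computes k fz (ev z)" "computes (Suc (Suc k)) fs (ev s)"
    "computes k fn (ev n)" using Rec.IH by metis
  have "computes k (Comp (Prec fz fs) ([fn] @ map Proj [0..<0 + k])) (ev (Rec z s n))"
    unfolding computes_def
  proof safe
    fix xs :: "nat list" assume len: "k = length xs"
    have 1: "computes (length [ev n xs] + k) (Prec fz fs)
        (\<lambda>ys. rec_nat (ev z (tl ys)) (\<lambda>i y. ev s (i # y # tl ys)) (hd ys))"
      unfolding computes_def
    proof safe
      fix zs :: "nat list" assume "length zs = length [ev n xs] + k"
      then obtain a cs where zs: "zs = a # cs" and cs: "length cs = k"
        by (auto simp: length_Suc_conv)
      show "eval_recf (Prec fz fs) zs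
          (rec_nat (ev z (tl zs)) (\<lambda>i y. ev s (i # y # tl zs)) (hd zs))"
        unfolding zs list.sel by (rule eval_recf_Prec) (use f cs in \<open>auto simp: computes_def\<close>)
    qed
    have "eval_recf (Comp (Prec fz fs) ([fn] @ map Proj [0..<0 + k])) xs
        ((\<lambda>ys. rec_nat (ev z (tl ys)) (\<lambda>i y. ev s (i # y # tl ys)) (hd ys)) ([ev n xs] @ drop 0 xs))"
      by (rule computes_Comp_rest[where pre = "\<lambda>_. [ev n xs]", OF 1])
        (use f(3) len in \<open>auto simp: computes_def\<close>)
    then show "eval_recf (Comp (Prec fz fs) ([fn] @ map Proj [0..<0 + length xs])) xs (ev (Rec z s n) xs)"
      using len by simp
  qed
  then show ?case by blast
next
  case (BEx n p)
  obtain fn fp where "computes k fn (ev n)" "computes (Suc k) fp (ev p)" using BEx.IH by metis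
  from computes_BEx[OF this] show ?case by (simp add: computes_def)
qed

section \<open>Connectives and bounded quantifiers as expressions\<close>

definition holds :: "pexp \<Rightarrow> nat list \<Rightarrow> bool" where
  "holds e xs \<longleftrightarrow> ev e xs \<noteq> 0"

text \<open>Recursion on the condition: zero rounds return \<open>b\<close>, any positive number
  returns \<open>a\<close>, which the two bound variables have shifted to index 3.\<close>

definition "CondE c a b = Call (Rec (Var 2) (Var 3) (Var 0)) [c, a, b]"
definition "NotE p = CondE p Nul (Inc Nul)"
definition "AndE p q = CondE p q Nul"
definition "ImpE p q = CondE p q (Inc Nul)"
definition "AllE n p = NotE (BEx n (NotE p))"

lemma ev_CondE [simp]: "ev (CondE c a b) xs = (if holds c xs then ev a xs else ev b xs)"
  by (cases "ev c xs") (simp_all add: CondE_def holds_def)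

lemma ev_NotE [simp]: "ev (NotE p) xs = (if holds p xs then 0 else 1)"
  by (simp add: NotE_def)

lemma holds_NotE [simp]: "holds (NotE p) xs \<longleftrightarrow> \<not> holds p xs"
  by (simp add: holds_def[of "NotE p"])

lemma holds_AndE [simp]: "holds (AndE p q) xs \<longleftrightarrow> holds p xs \<and> holds q xs"
  by (simp add: AndE_def holds_def[of "CondE _ _ _"]) (simp add: holds_def)

lemma holds_ImpE [simp]: "holds (ImpE p q) xs \<longleftrightarrow> (holds p xs \<longrightarrow> holds q xs)"
  by (simp add: ImpE_def holds_def[of "CondE _ _ _"]) (simp add: holds_def)

lemma holds_BEx [simp]: "holds (BEx n p) xs \<longleftrightarrow> (\<exists>i<ev n xs. holds p (i # xs))"
  by (simp add: holds_def)

lemma holds_AllE [simp]: "holds (AllE n p) xs \<longleftrightarrow> (\<forall>i<ev n xs. holds p (i # xs))"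
  by (auto simp: AllE_def)

lemma holds_Call [simp]: "holds (Call e es) xs \<longleftrightarrow> holds e (map (\<lambda>e'. ev e' xs) es)"
  by (simp add: holds_def)

text \<open>Truth only means a nonzero value; the conditional normalises it to the output 0 or
  1.\<close>

lemma decidable_onI:
  assumes "\<And>x. valid x \<Longrightarrow> holds e [enc x] \<longleftrightarrow> P x"
  shows "decidable_on enc valid P"
proof -
  obtain f where f: "computes 1 f (ev (CondE e (Inc Nul) Nul))" using ev_computable by blast
  have "eval_recf f [enc x] (if P x then 1 else 0)" if "valid x" for x
    using f[unfolded computes_def, rule_format, of "[enc x]"] assms[OF that]
    by (cases "P x") simp_all
  then show ?thesis unfolding decidable_on_def by blast
qed

section \<open>Arithmetic and bit membership\<close>

definition "PlusE a b = Rec a (Inc (Var 1)) b"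
text \<open>\<open>Call\<close> puts both factors at known positions, so that \<open>b\<close> has
  index 3 inside the recursion step.\<close>

definition "TimesE a b = Call (Rec Nul (PlusE (Var 1) (Var 3)) (Var 0)) [a, b]"
definition "PredE a = Rec Nul (Var 0) a"
definition "MonusE a b = Rec a (PredE (Var 1)) b"
definition "Pow2E a = Rec (Inc Nul) (PlusE (Var 1) (Var 1)) a"
definition "LeE a b = NotE (MonusE a b)"
definition "ParityE a = Rec Nul (NotE (Var 1)) a"
text \<open>\<open>Suc i div 2\<close> exceeds \<open>i div 2\<close> exactly when \<open>i\<close>
  is odd.\<close>

definition "HalfE a = Rec Nul (PlusE (Var 1) (ParityE (Var 0))) a"
definition "MemE i x = ParityE (Rec x (HalfE (Var 1)) i)"

lemma ev_PlusE [simp]: "ev (PlusE a b) xs = ev a xs + ev b xs"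
proof -
  have "rec_nat x (\<lambda>i y. Suc y) n = x + n" for x n by (induction n) auto
  then show ?thesis by (simp add: PlusE_def)
qed

lemma ev_TimesE [simp]: "ev (TimesE a b) xs = ev a xs * ev b xs"
proof -
  have "rec_nat 0 (\<lambda>i y. y + x) n = n * x" for x n :: nat by (induction n) auto
  then show ?thesis by (simp add: TimesE_def)
qed

lemma ev_PredE [simp]: "ev (PredE a) xs = ev a xs - 1"
  by (cases "ev a xs") (simp_all add: PredE_def)

lemma ev_MonusE [simp]: "ev (MonusE a b) xs = ev a xs - ev b xs"
proof -
  have "rec_nat x (\<lambda>i y. y - Suc 0) n = x - n" for x n by (induction n) auto
  then show ?thesis by (simp add: MonusE_def)
qed

lemma ev_Pow2E [simp]: "ev (Pow2E a) xs = 2 ^ ev a xs"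
proof -
  have "rec_nat (Suc 0) (\<lambda>i y. y + y) n = 2 ^ n" for n by (induction n) auto
  then show ?thesis by (simp add: Pow2E_def)
qed

lemma holds_LeE [simp]: "holds (LeE a b) xs \<longleftrightarrow> ev a xs \<le> ev b xs"
  by (simp add: LeE_def) (simp add: holds_def)

lemma ev_ParityE [simp]: "ev (ParityE a) xs = ev a xs mod 2"
proof -
  have "rec_nat 0 (\<lambda>i y. if 0 < y then 0 else 1) n = n mod 2" for n :: nat
    by (induction n) (auto simp: mod_Suc)
  then show ?thesis by (simp add: ParityE_def holds_def)
qed

lemma ev_HalfE [simp]: "ev (HalfE a) xs = ev a xs div 2"
proof -
  have "rec_nat 0 (\<lambda>i y. y + i mod 2) n = n div 2" for n :: nat
    by (induction n) (auto, presburger)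
  then show ?thesis by (simp add: HalfE_def)
qed

lemma holds_MemE [simp]: "holds (MemE i x) xs \<longleftrightarrow> ev i xs \<in> set_decode (ev x xs)"
proof -
  have "rec_nat x (\<lambda>i y. y div 2) n = x div 2 ^ n" for x n :: nat
    by (induction n) (simp_all add: div_mult2_eq[symmetric] mult.commute)
  then show ?thesis by (simp add: holds_def MemE_def set_decode_def odd_iff_mod_2_eq_one)
qed

section \<open>Decoding pairs and lists\<close>

definition "TriE a = Rec Nul (PlusE (Var 1) (Inc (Var 0))) a"

text \<open>The antidiagonal of a code \<open>c\<close> is the largest \<open>s\<close> with \<open>triangle s \<le> c\<close>.\<close>
definition "DiagE c = Rec Nul (CondE (LeE (TriE (Inc (Var 1))) (Inc (Var 0))) (Inc (Var 1)) (Var 1)) c"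
text \<open>\<open>prod_encode (a, b)\<close> is \<open>triangle (a + b) + a\<close>, so
  \<open>a\<close> is the offset along the antidiagonal.\<close>

definition "FstE c = MonusE c (TriE (DiagE c))"
definition "SndE c = MonusE (DiagE c) (FstE c)"
text \<open>A nonempty list is coded as the successor of the pair of its head and coded
  tail.\<close>

definition "HdE c = FstE (PredE c)"
definition "TlE c = SndE (PredE c)"
definition "NthE c i = HdE (Rec c (TlE (Var 1)) i)"

lemma ev_TriE [simp]: "ev (TriE a) xs = triangle (ev a xs)"
proof -
  have "rec_nat 0 (\<lambda>i y. Suc (y + i)) n = triangle n" for n :: nat by (induction n) auto
  then show ?thesis by (simp add: TriE_def)
qed

lemma ev_DiagE:
  assumes "ev c xs = prod_encode (a, b)"
  shows "ev (DiagE c) xs = a + b"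
proof -
  let ?r = "rec_nat 0 (\<lambda>i y. if triangle (Suc y) \<le> Suc i then Suc y else y)"
  \<comment> \<open>Raising \<open>n\<close> by one reaches at most one new triangular number, so
    one comparison restores the invariant.\<close>
  have r: "triangle (?r n) \<le> n \<and> n < triangle (Suc (?r n))" for n
    by (induction n) auto
  have mono: "mono triangle" by (simp add: mono_iff_le_Suc)
  have uniq: "s = t" if "triangle s \<le> n" "n < triangle (Suc s)" "triangle t \<le> n" "n < triangle (Suc t)" for s t n
  proof (rule ccontr)
    assume "s \<noteq> t"
    then consider "Suc s \<le> t" | "Suc t \<le> s" by linarith
    then show False by cases (use monoD[OF mono] that in \<open>fastforce dest: le_less_trans\<close>)+
  qed
  have "?r (prod_encode (a, b)) = a + b"
    by (rule uniq[where n = "prod_encode (a, b)"]) (use r in \<open>auto simp: prod_encode_def\<close>)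
  then show ?thesis by (simp add: DiagE_def assms cong: if_cong)
qed

lemma ev_FstE: "ev c xs = prod_encode (a, b) \<Longrightarrow> ev (FstE c) xs = a"
  by (simp add: FstE_def ev_DiagE) (simp add: prod_encode_def)

lemma ev_SndE: "ev c xs = prod_encode (a, b) \<Longrightarrow> ev (SndE c) xs = b"
  by (simp add: SndE_def ev_DiagE ev_FstE)

lemma ev_NthE:
  assumes "ev c xs = list_encode ys" "ev i xs < length ys"
  shows "ev (NthE c i) xs = ys ! ev i xs"
proof -
  let ?s = "\<lambda>i y. ev (TlE (Var 1)) (i # y # xs)"
  have tl: "?s i (list_encode (z # zs)) = list_encode zs" for i z zs
    unfolding TlE_def by (rule ev_SndE[where a = z]) simp
  have "rec_nat (list_encode ys) ?s n = list_encode (drop n ys)" if "n < length ys" for n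
    using that
  proof (induction n)
    case (Suc n)
    have "drop n ys = ys ! n # drop (Suc n) ys" using Suc.prems by (simp add: Cons_nth_drop_Suc)
    then show ?case using Suc tl by simp
  qed simp
  note this[OF assms(2)]
  moreover have "drop (ev i xs) ys = ys ! ev i xs # drop (Suc (ev i xs)) ys"
    using assms(2) by (simp add: Cons_nth_drop_Suc)
  ultimately have "ev (PredE (Rec c (TlE (Var 1)) i)) xs
      = prod_encode (ys ! ev i xs, list_encode (drop (Suc (ev i xs)) ys))"
    by (simp add: assms(1))
  then show ?thesis unfolding NthE_def HdE_def by (rule ev_FstE)
qed

lemma ev_NthE_enc_list:
  assumes "ev c xs = enc_list e ys" "ev i xs < length ys"
  shows "ev (NthE c i) xs = e (ys ! ev i xs)"
  using ev_NthE[of c xs "map e ys" i] assms by (simp add: enc_list_def)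

text \<open>Nonnegative \<open>i\<close> has the even code \<open>2 i\<close>, negative
  \<open>i\<close> the odd code \<open>- 2 i - 1\<close>; the parity factor selects the case and
  \<open>Suc\<close> repairs the offset.\<close>

lemma int_encode_parts:
  "int (int_encode i * (1 - int_encode i mod 2)) = 2 * max i 0"
  "int (Suc (int_encode i) * (int_encode i mod 2)) = 2 * max (- i) 0"
  by (auto simp: int_encode_def sum_encode_def max_def mod_Suc)

text \<open>Since probabilities are nonnegative, testing the numerator for zero decides whether a
  transition is possible.\<close>

lemma holds_enc_rat_pos:
  assumes "ev c xs = enc_rat q"
  shows "holds (FstE c) xs \<longleftrightarrow> q \<noteq> 0"
proof -
  obtain a b where q: "quotient_of q = (a, b)" by (cases "quotient_of q")
  have "ev (FstE c) xs = int_encode a"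
    by (rule ev_FstE[where b = "int_encode b"]) (simp add: assms enc_rat_def q)
  moreover have "int_encode a = 0 \<longleftrightarrow> a = 0"
    by (auto simp: int_encode_def sum_encode_def)
  moreover have "a = 0 \<longleftrightarrow> q = 0"
    using quotient_of_div[OF q] quotient_of_denom_pos[OF q] by auto
  ultimately show ?thesis by (simp add: holds_def)
qed

text \<open>Cross-multiplication, with the negative parts of the numerators moved to the other side. The code of a
  nonnegative integer \<open>i\<close> is \<open>2 i\<close>, that of a negative one is odd.\<close>
definition "LeRatE x y =
  (let pos = \<lambda>a. TimesE a (MonusE (Inc Nul) (ParityE a)); neg = \<lambda>a. TimesE (Inc a) (ParityE a)
   in LeE (PlusE (TimesE (pos (FstE x)) (SndE y)) (TimesE (neg (FstE y)) (SndE x)))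
          (PlusE (TimesE (pos (FstE y)) (SndE x)) (TimesE (neg (FstE x)) (SndE y))))"

lemma holds_LeRatE:
  assumes "ev x xs = enc_rat q" "ev y xs = enc_rat r"
  shows "holds (LeRatE x y) xs \<longleftrightarrow> q \<le> r"
proof -
  obtain a b where q: "quotient_of q = (a, b)" by (cases "quotient_of q")
  obtain c d where r: "quotient_of r = (c, d)" by (cases "quotient_of r")
  note pos = quotient_of_denom_pos[OF q] quotient_of_denom_pos[OF r]
  have x: "ev x xs = prod_encode (int_encode a, int_encode b)"
    and y: "ev y xs = prod_encode (int_encode c, int_encode d)"
    using assms by (simp_all add: enc_rat_def q r)
  have bd: "int (int_encode b) = 2 * b" "int (int_encode d) = 2 * d"
    using pos by (auto simp: int_encode_def sum_encode_def)
  let ?p = "\<lambda>i. int_encode i * (1 - int_encode i mod 2)"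
  let ?n = "\<lambda>i. Suc (int_encode i) * (int_encode i mod 2)"
  have "holds (LeRatE x y) xs \<longleftrightarrow>
     ?p a * int_encode d + ?n c * int_encode b \<le> ?p c * int_encode b + ?n a * int_encode d"
    by (simp add: LeRatE_def Let_def ev_FstE[OF x] ev_SndE[OF x] ev_FstE[OF y] ev_SndE[OF y])
  also have "\<dots> \<longleftrightarrow> int (?p a) * int (int_encode d) + int (?n c) * int (int_encode b)
      \<le> int (?p c) * int (int_encode b) + int (?n a) * int (int_encode d)"
    by (simp only: of_nat_le_iff[where 'a = int, symmetric] of_nat_add of_nat_mult)
  \<comment> \<open>Every code contributes a factor 2, so a common factor 4 cancels, and the
    positive and negative parts recombine to the numerators.\<close>
  also have "\<dots> \<longleftrightarrow> a * d \<le> c * b"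
    unfolding int_encode_parts bd by (auto simp: max_def algebra_simps)
  also have "\<dots> \<longleftrightarrow> rat_of_int a * rat_of_int d \<le> rat_of_int c * rat_of_int b"
    by (simp only: of_int_mult[symmetric] of_int_le_iff)
  also have "\<dots> \<longleftrightarrow> q \<le> r"
    using pos unfolding quotient_of_div[OF q] quotient_of_div[OF r]
    by (simp add: divide_simps mult.commute)
  finally show ?thesis .
qed

section \<open>The measure on runs\<close>

lemma rhoI_nonneg: "wf_pwa A \<Longrightarrow> 0 \<le> rhoI A q"
  by (auto simp: wf_pwa_def distr_list_def rhoI_def)

lemma delta_nonneg: "wf_pwa A \<Longrightarrow> 0 \<le> delta A p a q"
  by (auto simp: wf_pwa_def distr_list_def delta_def)

lemma sum_distr_list: "distr_list n xs \<Longrightarrow> (\<Sum>q<n. real_of_rat (xs ! q)) = 1"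
proof -
  assume d: "distr_list n xs"
  have "(\<Sum>q<n. real_of_rat (xs ! q)) = real_of_rat (\<Sum>q<n. xs ! q)" by (simp add: of_rat_sum)
  also have "(\<Sum>q<n. xs ! q) = sum_list xs"
    using d by (simp add: distr_list_def sum_list_sum_nth lessThan_atLeast0)
  finally show ?thesis using d by (simp add: distr_list_def)
qed

lemma sum_rhoI: "wf_pwa A \<Longrightarrow> (\<Sum>q<nstates A. rhoI A q) = 1"
  using sum_distr_list[of "nstates A" "init A"] by (simp add: wf_pwa_def rhoI_def)

lemma sum_delta:
  assumes "wf_pwa A" "p < nstates A" "a < nletters A"
  shows "(\<Sum>q<nstates A. delta A p a q) = 1"
  using sum_distr_list[of "nstates A" "trans A ! p ! a"] assms by (simp add: wf_pwa_def delta_def)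

lemma rhoI_outside: "\<not> q < nstates A \<Longrightarrow> rhoI A q = 0"
  by (simp add: rhoI_def)

lemma delta_outside: "\<not> q < nstates A \<Longrightarrow> delta A p a q = 0"
  by (simp add: delta_def)

lemma ex_pmf_finite_support:
  assumes "finite X" "\<And>x. 0 \<le> f x" "\<And>x. x \<notin> X \<Longrightarrow> f x = 0" "sum f X = 1"
  shows "\<exists>p. \<forall>x. pmf p x = f x"
proof -
  have "(\<integral>\<^sup>+x. ennreal (f x) \<partial>count_space UNIV) = (\<Sum>x\<in>X. ennreal (f x))"
    by (rule nn_integral_count_space'[OF assms(1)]) (use assms(3) in auto)
  also have "\<dots> = 1" using assms by (simp add: sum_ennreal)
  finally show ?thesis using assms(2) pmf_embed_pmf[of f] by blast
qed

section \<open>Cylinders and uniqueness of the run measure\<close>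

lemma space_run_space [simp]: "space run_space = UNIV"
  by (simp add: run_space_def space_PiM)

lemma measurable_state [measurable]: "(\<lambda>r. r i) \<in> measurable run_space (count_space UNIV)"
  unfolding run_space_def by measurable

lemma mem_cylinder: "r \<in> cylinder qs \<longleftrightarrow> (\<forall>i<length qs. r i = qs ! i)"
  by (simp add: cylinder_def)

lemma sets_cylinder [measurable]: "cylinder qs \<in> sets run_space"
  unfolding cylinder_def by measurable

lemma cylinder_snoc:
  "r \<in> cylinder (qs @ [q]) \<longleftrightarrow> r \<in> cylinder qs \<and> r (length qs) = q"
  by (auto simp: mem_cylinder nth_append All_less_Suc)

lemma mem_cylinder_map: "r \<in> cylinder (map r [0..<k])"
  by (simp add: mem_cylinder)

lemma Int_cylinder:
  assumes "r \<in> cylinder qs" "r \<in> cylinder ps" "length qs \<le> length ps"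
  shows "cylinder qs \<inter> cylinder ps = cylinder ps"
proof -
  have "cylinder ps \<subseteq> cylinder qs"
    using assms by (simp add: subset_iff mem_cylinder)
  then show ?thesis by blast
qed

text \<open>The empty set is included for stability under intersection; the empty prefix is left out
  because \<open>run_measure\<close> is specified on nonempty prefixes only.\<close>

definition cylinders :: "(nat \<Rightarrow> nat) set set" where
  "cylinders = insert {} (cylinder ` {qs. qs \<noteq> []})"

lemma Int_stable_cylinders: "Int_stable cylinders"
proof (rule Int_stableI)
  fix X Y assume X: "X \<in> cylinders" and Y: "Y \<in> cylinders"
  show "X \<inter> Y \<in> cylinders"
  proof (cases "X \<inter> Y = {}")
    case False
    then obtain r where r: "r \<in> X" "r \<in> Y" by blast
    then obtain qs ps where qs: "X = cylinder qs" "Y = cylinder ps"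
      using X Y by (auto simp: cylinders_def)
    \<comment> \<open>A common run makes the cylinders nested, the longer prefix giving the smaller
      set.\<close>
    have "X \<inter> Y = X \<or> X \<inter> Y = Y"
    proof (cases "length qs \<le> length ps")
      case True
      then show ?thesis using Int_cylinder[of r qs ps] r qs by simp
    next
      case False
      then show ?thesis using Int_cylinder[of r ps qs] r qs by (simp add: Int_commute)
    qed
    then show ?thesis using X Y by auto
  qed (simp add: cylinders_def)
qed

text \<open>There are countably many prefixes of a given length, so an event about coordinate
  \<open>i\<close> is a countable union of cylinders of length \<open>Suc i\<close>.\<close>

lemma sets_run_space: "sets run_space = sigma_sets UNIV cylinders"
proof
  have "{r. r i \<in> B} \<in> sigma_sets UNIV cylinders" for i and B :: "nat set"
  proof -
    have "{r. r i \<in> B} = \<Union> (cylinder ` {qs. length qs = Suc i \<and> qs ! i \<in> B})"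
    proof (intro subset_antisym subsetI)
      fix r assume "r \<in> {r. r i \<in> B}"
      then have "map r [0..<Suc i] \<in> {qs. length qs = Suc i \<and> qs ! i \<in> B}"
        by (simp add: nth_append)
      then show "r \<in> \<Union> (cylinder ` {qs. length qs = Suc i \<and> qs ! i \<in> B})"
        using mem_cylinder_map by blast
    next
      fix r assume "r \<in> \<Union> (cylinder ` {qs. length qs = Suc i \<and> qs ! i \<in> B})"
      then obtain qs where "length qs = Suc i" "qs ! i \<in> B" "r \<in> cylinder qs" by blast
      then show "r \<in> {r. r i \<in> B}" by (simp add: mem_cylinder)
    qed
    also have "\<dots> \<in> sigma_sets UNIV cylinders"
    proof (rule sigma_sets_UNION)
      fix X assume "X \<in> cylinder ` {qs. length qs = Suc i \<and> qs ! i \<in> B}"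
      then obtain qs where "X = cylinder qs" "length qs = Suc i" by blast
      then have "X \<in> cylinders" unfolding cylinders_def by (intro insertI2 image_eqI[of _ _ qs]) auto
      then show "X \<in> sigma_sets UNIV cylinders" by (rule sigma_sets.Basic)
    qed simp
    finally show ?thesis .
  qed
  then have "{{r \<in> UNIV. r i \<in> B} |i B. i \<in> UNIV \<and> B \<in> sets (count_space (UNIV :: nat set))}
      \<subseteq> sigma_sets UNIV cylinders" by (simp add: subset_iff) blast
  then show "sets run_space \<subseteq> sigma_sets UNIV cylinders"
    unfolding run_space_def sets_PiM_single space_count_space PiE_UNIV_domain Pi_UNIV
    by (rule sigma_sets_mono)
  have "cylinders \<subseteq> sets run_space" by (auto simp: cylinders_def)
  then show "sigma_sets UNIV cylinders \<subseteq> sets run_space"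
    using sets.sigma_sets_subset[of cylinders run_space] by simp
qed

text \<open>Cylinders form an intersection-stable generator, and the countably many of length 1
  cover the space, each with finite measure.\<close>

lemma run_measure_unique:
  assumes "sets M = sets run_space" "sets N = sets run_space"
    and "\<And>qs. qs \<noteq> [] \<Longrightarrow> emeasure M (cylinder qs) = ennreal (f qs)"
    and "\<And>qs. qs \<noteq> [] \<Longrightarrow> emeasure N (cylinder qs) = ennreal (f qs)"
  shows "M = N"
proof (rule measure_eqI_generator_eq_countable[where E = cylinders and \<Omega> = UNIV
      and A = "cylinder ` {qs. length qs = 1}"])
  show "\<Union> (cylinder ` {qs. length qs = 1}) = UNIV"
  proof (intro subset_antisym subsetI)
    show "r \<in> \<Union> (cylinder ` {qs. length qs = 1})" for r
      by (rule UN_I[of "map r [0..<1]"]) (simp_all add: mem_cylinder)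
  qed simp
  show "cylinder ` {qs. length qs = 1} \<subseteq> cylinders"
    by (auto simp: cylinders_def intro!: imageI)
  show "emeasure M X = emeasure N X" if "X \<in> cylinders" for X
    using that assms(3,4) unfolding cylinders_def by fastforce
  show "emeasure M X \<noteq> \<infinity>" if X: "X \<in> cylinder ` {qs. length qs = 1}" for X
  proof -
    obtain qs where "X = cylinder qs" "length qs = 1" using X by blast
    then show ?thesis using assms(3)[of qs] by fastforce
  qed
qed (simp_all add: assms(1,2) Int_stable_cylinders sets_run_space)

section \<open>Existence of the run measure\<close>

lemma prefix_prob_snoc:
  assumes "qs \<noteq> []"
  shows "prefix_prob A w (qs @ [q])
    = prefix_prob A w qs * delta A (last qs) (w (length qs - 1)) q"
proof -
  have "{1..<length (qs @ [q])} = insert (length qs) {1..<length qs}"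
    using assms by (auto simp: less_Suc_eq Suc_le_eq)
  then have "prefix_prob A w (qs @ [q]) = rhoI A (qs ! 0) *
      (delta A (last qs) (w (length qs - 1)) q *
       (\<Prod>i\<in>{1..<length qs}. delta A ((qs @ [q]) ! (i - 1)) (w (i - 1)) ((qs @ [q]) ! i)))"
    using assms by (simp add: prefix_prob_def nth_append last_conv_nth)
  also have "(\<Prod>i\<in>{1..<length qs}. delta A ((qs @ [q]) ! (i - 1)) (w (i - 1)) ((qs @ [q]) ! i))
     = (\<Prod>i\<in>{1..<length qs}. delta A (qs ! (i - 1)) (w (i - 1)) (qs ! i))"
    by (rule prod.cong) (auto simp: nth_append)
  finally show ?thesis by (simp add: prefix_prob_def)
qed

lemma prefix_prob_single: "prefix_prob A w [q] = rhoI A q"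
  by (simp add: prefix_prob_def)

lemma prefix_prob_nonneg: "wf_pwa A \<Longrightarrow> 0 \<le> prefix_prob A w qs"
  by (simp add: prefix_prob_def rhoI_nonneg delta_nonneg prod_nonneg)

text \<open>Independent random choices, one for the initial state and one successor for every
  time and state, are drawn in advance; the run just follows them.\<close>
fun follow :: "(nat \<times> nat \<Rightarrow> nat) \<Rightarrow> nat \<Rightarrow> nat" where
  "follow \<omega> 0 = \<omega> (0, 0)"
| "follow \<omega> (Suc i) = \<omega> (Suc i, follow \<omega> i)"

text \<open>The choice consulted at time \<open>i\<close> by a run along \<open>qs\<close>. At time
  0 there is no previous state, and 0 serves as a dummy.\<close>

definition choice_index :: "nat list \<Rightarrow> nat \<Rightarrow> nat \<times> nat" where
  "choice_index qs i = (i, if i = 0 then 0 else qs ! (i - 1))"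

lemma fst_choice_index: "fst (choice_index qs i) = i"
  by (simp add: choice_index_def)

text \<open>The run picks its choices adaptively, but staying on \<open>qs\<close> fixes in advance
  which ones are consulted; a cylinder thus becomes a rectangle in the product space.\<close>

lemma follow_in_cylinder:
  "follow \<omega> \<in> cylinder qs \<longleftrightarrow> (\<forall>i<length qs. \<omega> (choice_index qs i) = qs ! i)"
proof -
  have "(\<forall>i<k. follow \<omega> i = qs ! i) \<longleftrightarrow> (\<forall>i<k. \<omega> (choice_index qs i) = qs ! i)" for k
  proof (induction k)
    case (Suc k)
    have "follow \<omega> k = \<omega> (choice_index qs k)" if "\<forall>i<k. follow \<omega> i = qs ! i"
      using that by (cases k) (auto simp: choice_index_def)
    then show ?case using Suc.IH by (auto simp: All_less_Suc)
  qed simp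
  then show ?thesis by (simp add: mem_cylinder)
qed

text \<open>The law of \<open>follow\<close> under the product of all one-step distributions works,
  since a cylinder constrains finitely many distinct, hence independent, choices.\<close>

lemma run_measure_exists:
  assumes wf: "wf_pwa A" and w: "w \<in> words A"
  shows "\<exists>M. sets M = sets run_space \<and> prob_space M \<and>
      (\<forall>qs. qs \<noteq> [] \<longrightarrow> emeasure M (cylinder qs) = ennreal (prefix_prob A w qs))"
proof -
  define n where "n = nstates A"
  have "\<exists>p. \<forall>q. pmf p q = rhoI A q"
    by (rule ex_pmf_finite_support[of "{..<n}"])
      (use rhoI_nonneg sum_rhoI rhoI_outside wf in \<open>auto simp: n_def\<close>)
  then obtain I where I: "\<And>q. pmf I q = rhoI A q" by blast
  \<comment> \<open>Outside the state range \<open>delta\<close> is constantly 0 and no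
    distribution, so \<open>D\<close> is constrained only on genuine states.\<close>
  have "\<exists>D. p < n \<longrightarrow> (\<forall>q. pmf D q = delta A p (w i) q)" for i p
  proof (cases "p < n")
    case True
    have "\<exists>D. \<forall>q. pmf D q = delta A p (w i) q"
      by (rule ex_pmf_finite_support[of "{..<n}"])
        (use delta_nonneg sum_delta delta_outside wf w True in \<open>auto simp: n_def words_def\<close>)
    then show ?thesis by blast
  qed simp
  then have "\<exists>D. \<forall>i p. p < n \<longrightarrow> (\<forall>q. pmf (D i p) q = delta A p (w i) q)"
    by (intro choice allI)
  then obtain D where D: "\<And>i p q. p < n \<Longrightarrow> pmf (D i p) q = delta A p (w i) q" by blast
  define K where "K = (\<lambda>(i, p). case i of 0 \<Rightarrow> I | Suc j \<Rightarrow> D j p)"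
  interpret K: product_prob_space "\<lambda>x. measure_pmf (K x)" UNIV ..
  let ?P = "PiM UNIV (\<lambda>x. measure_pmf (K x))"
  have component: "(\<lambda>\<omega>. \<omega> x) \<in> measurable ?P (count_space UNIV)" for x
    using measurable_component_singleton[of x UNIV "\<lambda>x. measure_pmf (K x)"]
    by (simp add: measurable_cong_sets[OF refl sets_measure_pmf_count_space])
  have follow_i: "(\<lambda>\<omega>. follow \<omega> i) \<in> measurable ?P (count_space UNIV)" for i
  proof (induction i)
    case 0
    show ?case using component by simp
  next
    case (Suc i)
    have "(\<lambda>\<omega>. \<omega> (Suc i, follow \<omega> i)) \<in> measurable ?P (count_space UNIV)"
      by (rule measurable_compose_countable[OF _ Suc.IH]) (rule component)
    then show ?case by simp
  qed
  have follow: "follow \<in> measurable ?P run_space"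
    unfolding run_space_def by (rule measurable_PiM_single') (use follow_i in auto)
  define M where "M = distr ?P run_space follow"
  have "emeasure M (cylinder qs) = ennreal (prefix_prob A w qs)" if "qs \<noteq> []" for qs
  proof -
    let ?c = "choice_index qs" and ?l = "length qs"
    have inj: "inj_on ?c {..<?l}" by (auto simp: inj_on_def choice_index_def)
    have "emeasure M (cylinder qs) = emeasure ?P {\<omega> \<in> space ?P. \<forall>x\<in>?c ` {..<?l}. \<omega> x \<in> {qs ! fst x}}"
      unfolding M_def emeasure_distr[OF follow sets_cylinder]
      by (rule arg_cong[where f = "emeasure ?P"])
        (auto simp: follow_in_cylinder fst_choice_index)
    also have "\<dots> = (\<Prod>x\<in>?c ` {..<?l}. emeasure (measure_pmf (K x)) {qs ! fst x})"
      by (rule K.emeasure_PiM_Collect) auto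
    also have "\<dots> = (\<Prod>i<?l. ennreal (pmf (K (?c i)) (qs ! i)))"
      by (simp add: prod.reindex[OF inj] emeasure_pmf_single fst_choice_index)
    also have "\<dots> = ennreal (\<Prod>i<?l. pmf (K (?c i)) (qs ! i))"
      by (rule prod_ennreal) simp
    also have "(\<Prod>i<?l. pmf (K (?c i)) (qs ! i)) = prefix_prob A w qs"
      using that
    proof (induction qs rule: rev_nonempty_induct)
      case (single q)
      show ?case by (simp add: K_def choice_index_def I prefix_prob_single)
    next
      case (snoc q qs)
      have "(\<Prod>i<length qs. pmf (K (choice_index (qs @ [q]) i)) ((qs @ [q]) ! i))
          = (\<Prod>i<length qs. pmf (K (choice_index qs i)) (qs ! i))"
        by (rule prod.cong) (auto simp: nth_append choice_index_def)
      moreover have "K (choice_index (qs @ [q]) (length qs)) = D (length qs - 1) (last qs)"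
        using snoc.hyps by (cases "length qs") (auto simp: K_def choice_index_def nth_append last_conv_nth)
      \<comment> \<open>\<open>D\<close> is arbitrary when \<open>last qs\<close> is not a state,
        but then the prefix already has probability 0 and both sides vanish.\<close>
      moreover have "pmf (D (length qs - 1) (last qs)) q = delta A (last qs) (w (length qs - 1)) q
          \<or> prefix_prob A w qs = 0"
      proof (cases "last qs < n")
        case False
        show ?thesis
        proof (cases qs rule: rev_cases)
          case (snoc ps p)
          then show ?thesis using False prefix_prob_snoc[of ps A w p]
            by (cases "ps = []") (auto simp: prefix_prob_single n_def rhoI_outside delta_outside)
        qed (use snoc.hyps in simp)
      qed (simp add: D)
      ultimately show ?case
        using snoc.IH prefix_prob_snoc[OF snoc.hyps] by auto
    qed
    finally show ?thesis .
  qed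
  moreover have "prob_space M" unfolding M_def by (rule K.prob_space_distr[OF follow])
  moreover have "sets M = sets run_space" by (simp add: M_def)
  ultimately show ?thesis by blast
qed

lemma run_measure_props:
  assumes "wf_pwa A" "w \<in> words A"
  shows "sets (run_measure A w) = sets run_space" "prob_space (run_measure A w)"
    "qs \<noteq> [] \<Longrightarrow> emeasure (run_measure A w) (cylinder qs) = ennreal (prefix_prob A w qs)"
proof -
  let ?Q = "\<lambda>M. sets M = sets run_space \<and> prob_space M \<and>
      (\<forall>qs. qs \<noteq> [] \<longrightarrow> emeasure M (cylinder qs) = ennreal (prefix_prob A w qs))"
  have "\<exists>!M. ?Q M"
  proof (rule ex_ex1I)
    show "\<exists>M. ?Q M" by (rule run_measure_exists[OF assms])
    show "M = N" if "?Q M" "?Q N" for M N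
      by (rule run_measure_unique[where f = "prefix_prob A w"]) (use that in blast)+
  qed
  from theI'[OF this] have "?Q (run_measure A w)" unfolding run_measure_def .
  then show "sets (run_measure A w) = sets run_space" "prob_space (run_measure A w)"
    "qs \<noteq> [] \<Longrightarrow> emeasure (run_measure A w) (cylinder qs) = ennreal (prefix_prob A w qs)"
    by blast+
qed

section \<open>Eventually good runs and safe families of supports\<close>

lemma prefix_prob_cong:
  assumes "\<And>i. Suc i < length qs \<Longrightarrow> w i = w' i"
  shows "prefix_prob A w qs = prefix_prob A w' qs"
proof -
  have "(\<Prod>i\<in>{1..<length qs}. delta A (qs ! (i - 1)) (w (i - 1)) (qs ! i))
      = (\<Prod>i\<in>{1..<length qs}. delta A (qs ! (i - 1)) (w' (i - 1)) (qs ! i))"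
    by (rule prod.cong) (auto simp: assms)
  then show ?thesis by (simp add: prefix_prob_def)
qed

text \<open>The letter may change at every step: this is reachability under some finite
  word.\<close>

inductive reach :: "pwa \<Rightarrow> nat \<Rightarrow> bool" for A where
  init: "0 < rhoI A q \<Longrightarrow> reach A q"
| step: "reach A p \<Longrightarrow> 0 < delta A p a q \<Longrightarrow> reach A q"

lemma delta_pos_bounds:
  assumes "0 < delta A p a q"
  shows "p < nstates A" "a < nletters A" "q < nstates A"
  using assms by (auto simp: delta_def split: if_splits)

lemma reach_less: "reach A q \<Longrightarrow> q < nstates A"
  by (cases rule: reach.cases) (auto simp: rhoI_def delta_pos_bounds split: if_splits)

lemma reach_positive_prefix:
  assumes "reach A q" and "0 < nletters A"
  shows "\<exists>w\<in>words A. \<exists>qs. qs \<noteq> [] \<and> last qs = q \<and> 0 < prefix_prob A w qs"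
  using assms(1)
proof induction
  case (init q)
  then show ?case
    using assms(2) by (intro bexI[of _ "\<lambda>_. 0"] exI[of _ "[q]"]) (auto simp: prefix_prob_single words_def)
next
  case (step p a q)
  then obtain w qs where w: "w \<in> words A" "qs \<noteq> []" "last qs = p" "0 < prefix_prob A w qs" by blast
  \<comment> \<open>A prefix reads one letter fewer than it has states, so the letter at position
    \<open>length qs - 1\<close> is still free.\<close>
  define w' where "w' = w(length qs - 1 := a)"
  have "prefix_prob A w' qs = prefix_prob A w qs"
    by (rule prefix_prob_cong) (auto simp: w'_def)
  then have "0 < prefix_prob A w' (qs @ [q])"
    using w step.hyps by (simp add: prefix_prob_snoc w'_def)
  moreover have "w' \<in> words A"
    using w(1) delta_pos_bounds[OF step.hyps(2)] by (simp add: words_def w'_def)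
  ultimately show ?case by (intro bexI[of _ w'] exI[of _ "qs @ [q]"]) auto
qed

lemma positive_prefix_reach: "qs \<noteq> [] \<Longrightarrow> wf_pwa A \<Longrightarrow> prefix_prob A w qs \<noteq> 0 \<Longrightarrow> reach A (last qs)"
proof (induction qs rule: rev_nonempty_induct)
  case (single q)
  then show ?case using rhoI_nonneg[of A q] by (auto simp: prefix_prob_single intro!: reach.init)
next
  case (snoc q qs)
  then have "prefix_prob A w qs \<noteq> 0" "delta A (last qs) (w (length qs - 1)) q \<noteq> 0"
    by (auto simp: prefix_prob_snoc)
  then have "reach A (last qs)" "0 < delta A (last qs) (w (length qs - 1)) q"
    using snoc delta_nonneg[of A "last qs" "w (length qs - 1)" q] by auto
  then show ?case by (auto intro: reach.step)
qed

text \<open>The letter depends on the support \<open>S\<close> and not on the current state, because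
  a word cannot react to the run.\<close>

definition safe_family :: "pwa \<Rightarrow> (nat \<Rightarrow> nat \<Rightarrow> nat \<Rightarrow> bool) \<Rightarrow> nat set set \<Rightarrow> bool" where
  "safe_family A good W \<longleftrightarrow> W \<subseteq> Pow {..<nstates A} \<and>
     (\<forall>S\<in>W. \<exists>a<nletters A. \<exists>S'\<in>W. \<forall>p\<in>S. \<forall>q. 0 < delta A p a q \<longrightarrow> good p a q \<and> q \<in> S')"

text \<open>A single reachable state suffices as a start, since some prefix leading to it has
  positive probability.\<close>

definition reachably_safe :: "pwa \<Rightarrow> (nat \<Rightarrow> nat \<Rightarrow> nat \<Rightarrow> bool) \<Rightarrow> bool" where
  "reachably_safe A good \<longleftrightarrow> (\<exists>W. safe_family A good W \<and> (\<exists>q. reach A q \<and> {q} \<in> W))"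

section \<open>Survival probabilities\<close>

text \<open>The probability that the \<open>L\<close> transitions from state \<open>p\<close> at
  time \<open>i\<close> onwards are all good; \<open>sure\<close> is its qualitative
  counterpart.\<close>

fun survive :: "pwa \<Rightarrow> (nat \<Rightarrow> nat) \<Rightarrow> (nat \<Rightarrow> nat \<Rightarrow> nat \<Rightarrow> bool) \<Rightarrow> nat \<Rightarrow> nat \<Rightarrow> nat \<Rightarrow> real" where
  "survive A w good 0 i p = 1"
| "survive A w good (Suc L) i p =
    (\<Sum>q<nstates A. if good p (w i) q then delta A p (w i) q * survive A w good L (Suc i) q else 0)"

fun sure :: "pwa \<Rightarrow> (nat \<Rightarrow> nat) \<Rightarrow> (nat \<Rightarrow> nat \<Rightarrow> nat \<Rightarrow> bool) \<Rightarrow> nat \<Rightarrow> nat \<Rightarrow> nat \<Rightarrow> bool" where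
  "sure A w good 0 i p \<longleftrightarrow> True"
| "sure A w good (Suc L) i p \<longleftrightarrow>
    (\<forall>q. 0 < delta A p (w i) q \<longrightarrow> good p (w i) q \<and> sure A w good L (Suc i) q)"

lemma delta_lower_bound: "\<exists>e>0. e \<le> 1 \<and> (\<forall>p a q. 0 < delta A p a q \<longrightarrow> e \<le> delta A p a q)"
proof -
  let ?X = "(\<lambda>(p, a, q). delta A p a q) ` ({..<nstates A} \<times> {..<nletters A} \<times> {..<nstates A})"
  \<comment> \<open>The element 1 keeps the set nonempty and bounds the minimum by 1.\<close>
  let ?Y = "insert 1 {x \<in> ?X. 0 < x}"
  have fin: "finite ?Y" by auto
  have "Min ?Y \<le> delta A p a q" if "0 < delta A p a q" for p a q
    by (rule Min_le[OF fin]) (use that delta_pos_bounds[OF that] in force)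
  moreover have "0 < Min ?Y" using fin by (subst Min_gr_iff) auto
  moreover have "Min ?Y \<le> 1" by (rule Min_le[OF fin]) simp
  ultimately show ?thesis by blast
qed

lemma survive_nonneg: "wf_pwa A \<Longrightarrow> 0 \<le> survive A w good L i p"
  by (induction L arbitrary: i p) (auto intro!: sum_nonneg simp: delta_nonneg)

lemma survive_le_one:
  assumes "wf_pwa A" "w \<in> words A" "p < nstates A"
  shows "survive A w good L i p \<le> 1"
  using assms(3)
proof (induction L arbitrary: i p)
  case (Suc L)
  have "survive A w good (Suc L) i p \<le> (\<Sum>q<nstates A. delta A p (w i) q)"
    unfolding survive.simps
    by (rule sum_mono) (auto intro!: mult_left_le Suc.IH simp: delta_nonneg[OF assms(1)])
  also have "\<dots> = 1" using sum_delta assms(1,2) Suc.prems by (simp add: words_def)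
  finally show ?case .
qed simp

text \<open>Some path of at most \<open>L\<close> positive steps ends in a bad transition; its
  probability, at least \<open>e ^ L\<close>, is lost.\<close>

lemma survive_not_sure:
  assumes "wf_pwa A" "w \<in> words A" "p < nstates A" "\<not> sure A w good L i p"
    and e: "0 < e" "\<And>p a q. 0 < delta A p a q \<Longrightarrow> e \<le> delta A p a q"
  shows "survive A w good L i p \<le> 1 - e ^ L"
  using assms(3,4)
proof (induction L arbitrary: i p)
  case (Suc L)
  then obtain q where q: "0 < delta A p (w i) q" "\<not> good p (w i) q \<or> \<not> sure A w good L (Suc i) q" by auto
  note nn = delta_nonneg[OF assms(1)]
  let ?d = "\<lambda>q'. delta A p (w i) q'"
  have "survive A w good (Suc L) i p \<le> (\<Sum>q'<nstates A. ?d q' - (if q' = q then ?d q * e ^ L else 0))"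
    unfolding survive.simps
  proof (rule sum_mono)
    fix q' assume q': "q' \<in> {..<nstates A}"
    have 1: "?d q' * survive A w good L (Suc i) q' \<le> ?d q'"
      by (rule mult_left_le) (use q' survive_le_one[OF assms(1,2)] nn in auto)
    have 2: "?d q * survive A w good L (Suc i) q \<le> ?d q - ?d q * e ^ L" if "good p (w i) q"
    proof -
      have "survive A w good L (Suc i) q \<le> 1 - e ^ L"
        using q that delta_pos_bounds(3)[OF q(1)] by (intro Suc.IH) auto
      from mult_left_mono[OF this nn] show ?thesis by (simp add: algebra_simps)
    qed
    \<comment> \<open>If the transition to \<open>q\<close> is itself bad, its summand is 0, and the
      bound only has to be nonnegative.\<close>
    have "1 - e ^ L \<ge> 0" if "\<not> good p (w i) q"
    proof -
      have "?d q \<le> sum ?d {..<nstates A}"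
        by (rule member_le_sum) (use delta_pos_bounds(3)[OF q(1)] nn in auto)
      also have "\<dots> = 1" using sum_delta assms(1,2) Suc.prems by (simp add: words_def)
      finally have "e \<le> 1" using e(2)[OF q(1)] by simp
      then show ?thesis using e(1) by (simp add: power_le_one)
    qed
    then have 3: "0 \<le> ?d q - ?d q * e ^ L" if "\<not> good p (w i) q"
      using that mult_left_mono[of 0 "1 - e ^ L" "?d q"] nn by (simp add: algebra_simps)
    show "(if good p (w i) q' then ?d q' * survive A w good L (Suc i) q' else 0)
        \<le> ?d q' - (if q' = q then ?d q * e ^ L else 0)"
      using 1 2 3 nn[of p "w i" q'] by auto
  qed
  also have "\<dots> = 1 - ?d q * e ^ L"
    using delta_pos_bounds(3)[OF q(1)] sum_delta assms(1,2) Suc.prems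
    by (simp add: sum_subtractf words_def)
  also have "\<dots> \<le> 1 - e * e ^ L"
    using e(2)[OF q(1)] e(1) by (simp add: mult_right_mono)
  finally show ?case by simp
qed simp

text \<open>The block of length \<open>N\<close> sits at the end, so induction on \<open>L\<close>
  peels off first steps and stays within reachable states.\<close>

lemma survive_decay:
  assumes "wf_pwa A" and N: "\<And>p i. reach A p \<Longrightarrow> survive A w good N i p \<le> \<theta>" and "reach A p"
  shows "survive A w good (L + N) i p \<le> \<theta> * survive A w good L i p"
  using assms(3)
proof (induction L arbitrary: i p)
  case (Suc L)
  note nn = delta_nonneg[OF assms(1)]
  have "survive A w good (Suc L + N) i p \<le> (\<Sum>q<nstates A. \<theta> *
      (if good p (w i) q then delta A p (w i) q * survive A w good L (Suc i) q else 0))"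
    unfolding add_Suc survive.simps
  proof (rule sum_mono)
    fix q
    show "(if good p (w i) q then delta A p (w i) q * survive A w good (L + N) (Suc i) q else 0)
      \<le> \<theta> * (if good p (w i) q then delta A p (w i) q * survive A w good L (Suc i) q else 0)"
    proof (cases "delta A p (w i) q = 0")
      case False
      then have "reach A q" using Suc.prems nn by (metis reach.step order_le_less)
      from mult_left_mono[OF Suc.IH[OF this] nn] show ?thesis by (simp add: mult_ac)
    qed simp
  qed
  also have "\<dots> = \<theta> * survive A w good (Suc L) i p" by (simp add: sum_distrib_left)
  finally show ?case .
qed (use N in simp)

lemma survive_power_decay:
  assumes "wf_pwa A" "\<And>p i. reach A p \<Longrightarrow> survive A w good N i p \<le> \<theta>" "reach A p" "0 \<le> \<theta>"
  shows "survive A w good (k * N) i p \<le> \<theta> ^ k"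
proof (induction k)
  case (Suc k)
  have "survive A w good (k * N + N) i p \<le> \<theta> * survive A w good (k * N) i p"
    by (rule survive_decay[OF assms(1-3)])
  also have "\<dots> \<le> \<theta> * \<theta> ^ k" using Suc assms(4) by (intro mult_left_mono)
  finally show ?case by (simp add: add.commute)
qed simp

section \<open>Runs over a fixed word\<close>

locale pwa_word =
  fixes A :: pwa and w :: "nat \<Rightarrow> nat" and good :: "nat \<Rightarrow> nat \<Rightarrow> nat \<Rightarrow> bool"
  assumes wf: "wf_pwa A" and w: "w \<in> words A"
begin

abbreviation "M \<equiv> run_measure A w"

lemma sets_M [measurable_cong, simp]: "sets M = sets run_space"
  by (rule run_measure_props[OF wf w])

lemma space_M [simp]: "space M = UNIV"
  using sets_eq_imp_space_eq[OF sets_M] by simp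

sublocale prob_space M
  by (rule run_measure_props[OF wf w])

text \<open>For each length there are countably many prefixes of probability 0, and each of their
  cylinders is null.\<close>

lemma AE_prefix_prob: "AE r in M. \<forall>k. prefix_prob A w (map r [0..<Suc k]) \<noteq> 0"
proof (subst AE_all_countable, rule allI)
  fix k
  let ?Q = "{qs. length qs = Suc k \<and> prefix_prob A w qs = 0}"
  have "(\<Union>qs\<in>?Q. cylinder qs) \<in> null_sets M"
  proof (rule null_sets_UN')
    show "cylinder qs \<in> null_sets M" if qs: "qs \<in> ?Q" for qs
    proof (rule null_setsI)
      have "qs \<noteq> []" using qs by auto
      then show "emeasure M (cylinder qs) = 0"
        using qs run_measure_props(3)[OF wf w] by simp
    qed simp
  qed simp
  then show "AE r in M. prefix_prob A w (map r [0..<Suc k]) \<noteq> 0"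
  proof (rule AE_I')
    show "{r \<in> space M. \<not> prefix_prob A w (map r [0..<Suc k]) \<noteq> 0} \<subseteq> (\<Union>qs\<in>?Q. cylinder qs)"
    proof
      fix r assume "r \<in> {r \<in> space M. \<not> prefix_prob A w (map r [0..<Suc k]) \<noteq> 0}"
      then have "map r [0..<Suc k] \<in> ?Q" by simp
      then show "r \<in> (\<Union>qs\<in>?Q. cylinder qs)" using mem_cylinder_map by blast
    qed
  qed
qed

lemma AE_delta_pos: "AE r in M. \<forall>k. 0 < delta A (r k) (w k) (r (Suc k))"
  using AE_prefix_prob
proof eventually_elim
  case (elim r)
  show ?case
  proof
    fix k
    have "prefix_prob A w (map r [0..<Suc k] @ [r (Suc k)]) \<noteq> 0"
      using elim[rule_format, of "Suc k"] by simp
    then have "delta A (r k) (w k) (r (Suc k)) \<noteq> 0"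
      by (subst (asm) prefix_prob_snoc) auto
    then show "0 < delta A (r k) (w k) (r (Suc k))"
      using delta_nonneg[OF wf, of "r k" "w k" "r (Suc k)"] by linarith
  qed
qed

text \<open>Pairs of states form a countable discrete space, so an arbitrary predicate
  \<open>good\<close> is measurable.\<close>

lemma measurable_good [measurable]: "Measurable.pred run_space (\<lambda>r. good (r i) (w j) (r k))"
proof -
  have "(\<lambda>r. (r i, r k)) \<in> measurable run_space (count_space UNIV \<Otimes>\<^sub>M count_space UNIV)"
    by measurable
  then have "(\<lambda>r. (r i, r k)) \<in> measurable run_space (count_space (UNIV :: (nat \<times> nat) set))"
    by (simp add: pair_measure_countable)
  from measurable_compose[OF this, of "\<lambda>(p, q). good p (w j) q" "count_space UNIV"]
  show ?thesis by simp
qed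

abbreviation "eventually_good \<equiv> {r. \<exists>k. \<forall>i\<ge>k. good (r i) (w i) (r (Suc i))}"

lemma sets_eventually_good [measurable]: "eventually_good \<in> sets run_space"
proof -
  have "{r \<in> space run_space. \<exists>k. \<forall>i\<in>{k..}. good (r i) (w i) (r (Suc i))} \<in> sets run_space"
    by measurable
  then show ?thesis by (simp add: Ball_def)
qed

text \<open>Induction on \<open>L\<close>: the event splits by the next state into events of the
  same kind for \<open>qs\<close> extended by that state. The prefix ends at time
  \<open>length qs - 1\<close>, where survival starts to count.\<close>

lemma emeasure_survive_le:
  assumes "qs \<noteq> []"
  shows "emeasure M {r \<in> cylinder qs. \<forall>i<L. good (r (length qs - 1 + i)) (w (length qs - 1 + i)) (r (length qs + i))}
    \<le> ennreal (prefix_prob A w qs * survive A w good L (length qs - 1) (last qs))"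
  using assms
proof (induction L arbitrary: qs)
  case 0
  then show ?case using run_measure_props(3)[OF wf w] by simp
next
  case (Suc L)
  let ?c = "length qs - 1"
  let ?E = "\<lambda>L qs. {r \<in> cylinder qs. \<forall>i<L. good (r (length qs - 1 + i)) (w (length qs - 1 + i)) (r (length qs + i))}"
  \<comment> \<open>Almost surely the next state is a genuine one, so a finite union
    suffices.\<close>
  let ?Q = "{q. q < nstates A \<and> good (last qs) (w ?c) q}"
  have meas [measurable]: "?E L qs \<in> sets run_space" for L qs
  proof -
    have "?E L qs = cylinder qs \<inter> {r \<in> space run_space. \<forall>i\<in>{..<L}. good (r (length qs - 1 + i)) (w (length qs - 1 + i)) (r (length qs + i))}"
      by auto
    also have "\<dots> \<in> sets run_space" by measurable
    finally show ?thesis .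
  qed
  have "emeasure M (?E (Suc L) qs) \<le> emeasure M (\<Union>q\<in>?Q. ?E L (qs @ [q]))"
  proof (rule emeasure_mono_AE)
    show "AE r in M. r \<in> ?E (Suc L) qs \<longrightarrow> r \<in> (\<Union>q\<in>?Q. ?E L (qs @ [q]))"
      using AE_delta_pos
    proof eventually_elim
      case (elim r)
      show ?case
      proof
        assume r: "r \<in> ?E (Suc L) qs"
        let ?q = "r (length qs)"
        have "r ?c = last qs" using r Suc.prems by (auto simp: mem_cylinder last_conv_nth)
        moreover have good: "good (r (?c + i)) (w (?c + i)) (r (length qs + i))" if "i < Suc L" for i
          using r that by blast
        ultimately have "?q \<in> ?Q"
          using good[of 0] delta_pos_bounds(3)[OF elim[rule_format, of ?c]] Suc.prems by auto
        moreover have "r \<in> ?E L (qs @ [?q])"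
        proof -
          have "good (r (length qs + i)) (w (length qs + i)) (r (Suc (length qs + i)))" if "i < L" for i
            using good[of "Suc i"] that Suc.prems by (cases qs) auto
          then show ?thesis using r by (auto simp: cylinder_snoc)
        qed
        ultimately show "r \<in> (\<Union>q\<in>?Q. ?E L (qs @ [q]))" by blast
      qed
    qed
  qed (auto intro!: sets.finite_UN meas)
  also have "\<dots> \<le> (\<Sum>q\<in>?Q. emeasure M (?E L (qs @ [q])))"
    by (rule emeasure_subadditive_finite) (use meas in auto)
  also have "\<dots> \<le> (\<Sum>q\<in>?Q. ennreal (prefix_prob A w qs * (delta A (last qs) (w ?c) q * survive A w good L (length qs) q)))"
  proof (rule sum_mono)
    fix q
    show "emeasure M (?E L (qs @ [q])) \<le> ennreal (prefix_prob A w qs * (delta A (last qs) (w ?c) q * survive A w good L (length qs) q))"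
      using Suc.IH[of "qs @ [q]"] Suc.prems by (simp add: prefix_prob_snoc mult.assoc)
  qed
  also have "\<dots> = ennreal (\<Sum>q\<in>?Q. prefix_prob A w qs * (delta A (last qs) (w ?c) q * survive A w good L (length qs) q))"
    by (rule sum_ennreal) (auto intro!: mult_nonneg_nonneg prefix_prob_nonneg delta_nonneg survive_nonneg wf)
  also have "(\<Sum>q\<in>?Q. prefix_prob A w qs * (delta A (last qs) (w ?c) q * survive A w good L (length qs) q))
     = prefix_prob A w qs * survive A w good (Suc L) ?c (last qs)"
  proof -
    have "?Q = {q \<in> {..<nstates A}. good (last qs) (w ?c) q}" by auto
    then show ?thesis
      using Suc.prems by (simp add: sum.inter_filter sum_distrib_left[symmetric]
        del: mem_Collect_eq lessThan_iff cong: if_cong)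
  qed
  finally show ?case .
qed

lemma ex_sure_if_eventually_good:
  assumes pos: "0 < emeasure M eventually_good"
  shows "\<exists>p i. reach A p \<and> sure A w good N i p"
proof (rule ccontr)
  assume contra: "\<nexists>p i. reach A p \<and> sure A w good N i p"
  obtain e where e: "0 < e" "e \<le> 1" "\<And>p a q. 0 < delta A p a q \<Longrightarrow> e \<le> delta A p a q"
    using delta_lower_bound[of A] by blast
  define \<theta> where "\<theta> = 1 - e ^ N"
  have \<theta>: "0 \<le> \<theta>" "\<theta> < 1" using e by (auto simp: \<theta>_def power_le_one)
  have decay: "survive A w good N i p \<le> \<theta>" if "reach A p" for i p
    unfolding \<theta>_def using contra that reach_less e by (intro survive_not_sure wf w) auto
  \<comment> \<open>Fixing the prefix up to the time from which all is good covers the eventually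
    good runs by countably many events, each shown to be null.\<close>
  let ?G = "\<lambda>qs. {r \<in> cylinder qs. \<forall>i\<ge>length qs - 1. good (r i) (w i) (r (Suc i))}"
  have "?G qs \<in> null_sets M" if qs: "qs \<noteq> []" for qs
  proof (rule null_setsI)
    let ?p = "prefix_prob A w qs"
    have le: "emeasure M (?G qs) \<le> ennreal (?p * survive A w good L (length qs - 1) (last qs))" for L
    proof (rule order_trans[OF emeasure_mono emeasure_survive_le[OF qs, of L]])
      show "?G qs \<subseteq> {r \<in> cylinder qs. \<forall>i<L. good (r (length qs - 1 + i)) (w (length qs - 1 + i)) (r (length qs + i))}"
      proof safe
        fix r i assume "\<forall>i\<ge>length qs - 1. good (r i) (w i) (r (Suc i))"
        then have "good (r (length qs - 1 + i)) (w (length qs - 1 + i)) (r (Suc (length qs - 1 + i)))"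
          by auto
        then show "good (r (length qs - 1 + i)) (w (length qs - 1 + i)) (r (length qs + i))"
          using qs by (cases qs) auto
      qed
      have "{r \<in> cylinder qs. \<forall>i<L. good (r (length qs - 1 + i)) (w (length qs - 1 + i)) (r (length qs + i))}
        = cylinder qs \<inter> {r \<in> space run_space. \<forall>i\<in>{..<L}. good (r (length qs - 1 + i)) (w (length qs - 1 + i)) (r (length qs + i))}"
        by auto
      also have "\<dots> \<in> sets M" by measurable
      finally show "{r \<in> cylinder qs. \<forall>i<L. good (r (length qs - 1 + i)) (w (length qs - 1 + i)) (r (length qs + i))} \<in> sets M" .
    qed
    show "emeasure M (?G qs) = 0"
    proof (cases "?p = 0")
      case True
      then show ?thesis using le[of 0] by simp
    next
      case False
      then have "reach A (last qs)" by (rule positive_prefix_reach[OF qs wf])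
      then have s: "survive A w good (k * N) (length qs - 1) (last qs) \<le> \<theta> ^ k" for k
        using survive_power_decay[OF wf decay _ \<theta>(1)] by blast
      have "emeasure M (?G qs) \<le> ennreal (?p * \<theta> ^ k)" for k
        by (rule order_trans[OF le ennreal_leI[OF mult_left_mono[OF s prefix_prob_nonneg[OF wf]]]])
      moreover have "(\<lambda>k. ennreal (?p * \<theta> ^ k)) \<longlonglongrightarrow> ennreal (?p * 0)"
        by (intro tendsto_ennrealI tendsto_mult tendsto_const LIMSEQ_power_zero) (use \<theta> in simp)
      ultimately have "emeasure M (?G qs) \<le> ennreal (?p * 0)"
        by (intro LIMSEQ_le_const) auto
      then show ?thesis by simp
    qed
    have "?G qs = cylinder qs \<inter> {r \<in> space run_space. \<forall>i\<in>{length qs - 1..}. good (r i) (w i) (r (Suc i))}"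
      by auto
    also have "\<dots> \<in> sets M" by measurable
    finally show "?G qs \<in> sets M" .
  qed
  then have "(\<Union>qs\<in>{qs. qs \<noteq> []}. ?G qs) \<in> null_sets M" by (intro null_sets_UN') auto
  moreover have "eventually_good \<subseteq> (\<Union>qs\<in>{qs. qs \<noteq> []}. ?G qs)"
  proof safe
    fix r k assume "\<forall>i\<ge>k. good (r i) (w i) (r (Suc i))"
    then have "r \<in> ?G (map r [0..<Suc k])" using mem_cylinder_map[of r "Suc k"] by simp
    then show "r \<in> (\<Union>qs\<in>{qs. qs \<noteq> []}. ?G qs)" by (intro UN_I[of "map r [0..<Suc k]"]) auto
  qed
  ultimately have "eventually_good \<in> null_sets M"
    using null_sets_subset[of _ M eventually_good] by simp
  then show False using pos by (simp add: null_setsD1)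
qed

lemma safe_family_if_sure:
  assumes "reach A p" "sure A w good (2 ^ nstates A) i p"
  shows "\<exists>W. safe_family A good W \<and> {p} \<in> W"
proof -
  define N where "N = (2 ^ nstates A :: nat)"
  \<comment> \<open>\<open>S j\<close> is the set of states possible \<open>j\<close> steps after
    being in \<open>p\<close> at time \<open>i\<close>.\<close>
  define S where "S = rec_nat {p} (\<lambda>j S. {q. \<exists>p\<in>S. 0 < delta A p (w (i + j)) q})"
  have S0: "S 0 = {p}" and SS: "S (Suc j) = {q. \<exists>p\<in>S j. 0 < delta A p (w (i + j)) q}" for j
    by (simp_all add: S_def)
  have sub: "S j \<in> Pow {..<nstates A}" for j
    by (cases j) (use reach_less[OF assms(1)] delta_pos_bounds(3) in \<open>auto simp: S0 SS\<close>)
  have sure: "sure A w good (N - j) (i + j) q" if "j \<le> N" "q \<in> S j" for j q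
    using that
  proof (induction j arbitrary: q)
    case 0
    then show ?case using assms(2) by (simp add: S0 N_def)
  next
    case (Suc j)
    then obtain q' where "q' \<in> S j" "0 < delta A q' (w (i + j)) q" by (auto simp: SS)
    moreover have "N - j = Suc (N - Suc j)" using Suc.prems by simp
    ultimately show ?case using Suc.IH[of q'] Suc.prems by simp
  qed
  \<comment> \<open>The \<open>N + 1\<close> supports \<open>S 0\<close> to \<open>S N\<close> lie
    among only \<open>N\<close> subsets of the state set, so two coincide.\<close>
  have "card (S ` {..N}) \<le> card (Pow {..<nstates A})"
    by (rule card_mono) (use sub in auto)
  then have "card (S ` {..N}) < card {..N}" by (simp add: card_Pow N_def)
  then have "\<not> inj_on S {..N}" by (rule pigeonhole)
  then obtain a b where ab: "a < b" "b \<le> N" "S a = S b"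
    unfolding inj_on_def by (metis atMost_iff linorder_neqE_nat)
  \<comment> \<open>Supports before the second occurrence suffice: the successor of
    \<open>S (b - 1)\<close> is \<open>S b = S a\<close>, which closes the loop.\<close>
  let ?W = "S ` {..<b}"
  have "\<exists>a<nletters A. \<exists>S'\<in>?W. \<forall>p\<in>S j. \<forall>q. 0 < delta A p a q \<longrightarrow> good p a q \<and> q \<in> S'" if j: "j < b" for j
  proof (intro exI[of _ "w (i + j)"] conjI bexI[of _ "S (Suc j)"] ballI allI impI)
    show "w (i + j) < nletters A" using w by (simp add: words_def)
    show "S (Suc j) \<in> ?W"
      using ab j by (cases "Suc j = b") (auto intro: image_eqI[of _ _ a])
    fix p q assume pq: "p \<in> S j" "0 < delta A p (w (i + j)) q"
    have "N - j = Suc (N - Suc j)" using j ab by simp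
    then show "good p (w (i + j)) q" using sure[of j p] pq j ab by simp
    show "q \<in> S (Suc j)" using pq by (auto simp: SS)
  qed
  moreover have "?W \<subseteq> Pow {..<nstates A}" using sub by blast
  ultimately have "safe_family A good ?W" unfolding safe_family_def by blast
  moreover have "{p} \<in> ?W" using S0 ab by (auto intro!: image_eqI[of _ _ 0])
  ultimately show ?thesis by blast
qed

text \<open>\<open>T k\<close> confines the run \<open>k\<close> steps after the prefix. Almost
  every run takes only positive transitions, so the cylinder of \<open>qs\<close> lies in the event
  up to a null set.\<close>

lemma eventually_good_pos_if_prefix:
  assumes qs: "qs \<noteq> []" "0 < prefix_prob A w qs" "last qs \<in> T 0"
    and T: "\<And>k p q. p \<in> T k \<Longrightarrow> 0 < delta A p (w (length qs - 1 + k)) q \<Longrightarrow>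
      good p (w (length qs - 1 + k)) q \<and> q \<in> T (Suc k)"
  shows "0 < emeasure M eventually_good"
proof -
  let ?c = "length qs - 1"
  have "emeasure M (cylinder qs) \<le> emeasure M eventually_good"
  proof (rule emeasure_mono_AE)
    show "AE r in M. r \<in> cylinder qs \<longrightarrow> r \<in> eventually_good"
      using AE_delta_pos
    proof eventually_elim
      case (elim r)
      show ?case
      proof
        assume "r \<in> cylinder qs"
        then have "r ?c = last qs" using qs(1) by (auto simp: mem_cylinder last_conv_nth)
        then have "r (?c + k) \<in> T k" for k
        proof (induction k)
          case 0
          then show ?case using qs(3) by simp
        next
          case (Suc k)
          then show ?case using T[OF _ elim[rule_format, of "?c + k"]] by simp
        qed
        then have "good (r (?c + k)) (w (?c + k)) (r (Suc (?c + k)))" for k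
          using T[OF _ elim[rule_format, of "?c + k"]] by blast
        then have "\<forall>i\<ge>?c. good (r i) (w i) (r (Suc i))"
          by (metis le_add_diff_inverse)
        then show "r \<in> eventually_good" by blast
      qed
    qed
  qed simp
  moreover have "0 < emeasure M (cylinder qs)"
    using run_measure_props(3)[OF wf w qs(1)] qs(2) by simp
  ultimately show ?thesis by (rule less_le_trans[rotated])
qed

end

text \<open>With \<open>good\<close> arbitrary, one equivalence serves both problems: weights at
  least \<open>\<nu>\<close> for \<open>LimInf\<close>, below \<open>\<nu>\<close> for
  \<open>LimSup\<close>.\<close>

theorem ex_eventually_good_iff_reachably_safe:
  assumes wf: "wf_pwa A"
  shows "(\<exists>w\<in>words A. 0 < emeasure (run_measure A w) {r. \<exists>k. \<forall>i\<ge>k. good (r i) (w i) (r (Suc i))})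
    \<longleftrightarrow> reachably_safe A good"
proof
  assume "\<exists>w\<in>words A. 0 < emeasure (run_measure A w) {r. \<exists>k. \<forall>i\<ge>k. good (r i) (w i) (r (Suc i))}"
  then obtain w where w: "w \<in> words A"
    and pos: "0 < emeasure (run_measure A w) {r. \<exists>k. \<forall>i\<ge>k. good (r i) (w i) (r (Suc i))}" by blast
  interpret pwa_word A w good using wf w by unfold_locales
  show "reachably_safe A good"
    using ex_sure_if_eventually_good[OF pos] safe_family_if_sure unfolding reachably_safe_def by blast
next
  assume "reachably_safe A good"
  then obtain W q where W: "safe_family A good W" "reach A q" "{q} \<in> W"
    by (auto simp: reachably_safe_def)
  then have "\<forall>S\<in>W. \<exists>a S'. a < nletters A \<and> S' \<in> W \<and>
      (\<forall>p\<in>S. \<forall>q. 0 < delta A p a q \<longrightarrow> good p a q \<and> q \<in> S')"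
    unfolding safe_family_def by blast
  then obtain f g where fg: "\<And>S. S \<in> W \<Longrightarrow> f S < nletters A" "\<And>S. S \<in> W \<Longrightarrow> g S \<in> W"
    "\<And>S p q. S \<in> W \<Longrightarrow> p \<in> S \<Longrightarrow> 0 < delta A p (f S) q \<Longrightarrow> good p (f S) q \<and> q \<in> g S"
    by metis
  \<comment> \<open>Iterating \<open>g\<close> from \<open>{q}\<close> fixes the supports
    beforehand, so the letters \<open>f (T k)\<close> form a word.\<close>
  define T where "T k = (g ^^ k) {q}" for k
  have T: "T k \<in> W" for k by (induction k) (use W fg in \<open>auto simp: T_def\<close>)
  have "0 < nletters A" using fg(1)[OF W(3)] by simp
  then obtain u qs where u: "u \<in> words A" "qs \<noteq> []" "last qs = q" "0 < prefix_prob A u qs"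
    using reach_positive_prefix[OF W(2)] by blast
  \<comment> \<open>The letters of \<open>u\<close> lead to \<open>q\<close>; from time
    \<open>length qs - 1\<close>, when the run is in \<open>q\<close>, the choices of the family
    take over.\<close>
  define w where "w i = (if i < length qs - 1 then u i else f (T (i - (length qs - 1))))" for i
  have w: "w \<in> words A" using u(1) fg(1)[OF T] by (simp add: words_def w_def)
  have "prefix_prob A w qs = prefix_prob A u qs" by (rule prefix_prob_cong) (auto simp: w_def)
  then have prefix: "0 < prefix_prob A w qs" using u by simp
  interpret pwa_word A w good using wf w by unfold_locales
  have "0 < emeasure (run_measure A w) {r. \<exists>k. \<forall>i\<ge>k. good (r i) (w i) (r (Suc i))}"
  proof (rule eventually_good_pos_if_prefix[OF u(2) prefix])
    show "last qs \<in> T 0" by (simp add: T_def u)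
    show "good p (w (length qs - 1 + k)) q \<and> q \<in> T (Suc k)"
      if "p \<in> T k" "0 < delta A p (w (length qs - 1 + k)) q" for k p q
      using fg(3)[OF T that(1)] that(2) by (simp add: w_def) (simp add: T_def)
  qed
  then show "\<exists>w\<in>words A. 0 < emeasure (run_measure A w) {r. \<exists>k. \<forall>i\<ge>k. good (r i) (w i) (r (Suc i))}"
    using w by blast
qed

section \<open>Threshold values and the decision procedure\<close>

text \<open>A finite set leaves a gap below \<open>\<nu>\<close>, which turns limits over finitely
  many values into eventual statements. The element \<open>\<nu> - 1\<close> covers the case that
  nothing lies below.\<close>

lemma finite_gap:
  fixes \<nu> :: real
  assumes "finite X"
  shows "\<exists>c<\<nu>. \<forall>x\<in>X. x < \<nu> \<longrightarrow> x \<le> c"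
proof -
  let ?Y = "insert (\<nu> - 1) {x \<in> X. x < \<nu>}"
  have "Max ?Y < \<nu>" using assms by (subst Max_less_iff) auto
  moreover have "x \<le> Max ?Y" if "x \<in> X" "x < \<nu>" for x
    by (rule Max_ge) (use assms that in auto)
  ultimately show ?thesis by blast
qed

lemma le_LimInf_iff:
  assumes "finite X" "\<And>i. v i \<in> X"
  shows "ereal \<eta> \<le> LimInf v \<longleftrightarrow> (\<exists>k. \<forall>i\<ge>k. \<eta> \<le> v i)"
proof
  obtain c where c: "c < \<eta>" "\<And>x. x \<in> X \<Longrightarrow> x < \<eta> \<Longrightarrow> x \<le> c" using finite_gap[OF assms(1)] by blast
  assume "ereal \<eta> \<le> LimInf v"
  \<comment> \<open>The values are eventually above \<open>c\<close>, and none lies strictly between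
    \<open>c\<close> and \<open>\<eta>\<close>.\<close>
  then have "ereal c < liminf (\<lambda>n. ereal (v n))"
    using c(1) by (simp add: LimInf_def less_le_trans[of "ereal c" "ereal \<eta>"])
  from less_LiminfD[OF this] show "\<exists>k. \<forall>i\<ge>k. \<eta> \<le> v i"
    unfolding eventually_sequentially using c(2)[OF assms(2)] by (metis less_ereal.simps(1) not_less)
next
  assume "\<exists>k. \<forall>i\<ge>k. \<eta> \<le> v i"
  then show "ereal \<eta> \<le> LimInf v"
    unfolding LimInf_def by (intro Liminf_bounded) (auto simp: eventually_sequentially)
qed

lemma le_LimSup_iff:
  assumes "finite X" "\<And>i. v i \<in> X"
  shows "ereal \<eta> \<le> LimSup v \<longleftrightarrow> \<not> (\<exists>k. \<forall>i\<ge>k. v i < \<eta>)"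
proof -
  obtain c where c: "c < \<eta>" "\<And>x. x \<in> X \<Longrightarrow> x < \<eta> \<Longrightarrow> x \<le> c" using finite_gap[OF assms(1)] by blast
  have "LimSup v < ereal \<eta> \<longleftrightarrow> (\<exists>k. \<forall>i\<ge>k. v i < \<eta>)"
  proof
    assume "LimSup v < ereal \<eta>"
    from Limsup_lessD[OF this[unfolded LimSup_def]] show "\<exists>k. \<forall>i\<ge>k. v i < \<eta>"
      by (simp add: eventually_sequentially)
  next
    assume "\<exists>k. \<forall>i\<ge>k. v i < \<eta>"
    then have "LimSup v \<le> ereal c"
      unfolding LimSup_def using c(2)[OF assms(2)]
      by (intro Limsup_bounded) (auto simp: eventually_sequentially)
    also have "\<dots> < ereal \<eta>" using c(1) by simp
    finally show "LimSup v < ereal \<eta>" .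
  qed
  then show ?thesis by (simp add: not_less[symmetric])
qed

text \<open>A supremum that reaches \<open>\<nu>\<close> yields some \<open>\<eta>\<close> beyond
  \<open>c\<close> with \<open>Q \<eta>\<close>, which carries over to \<open>\<nu>\<close>; the
  supremum in the semantics thus becomes a single test.\<close>

lemma le_Sup_threshold_iff:
  assumes "c < \<nu>" "\<And>\<eta>. Q \<eta> \<Longrightarrow> c < \<eta> \<Longrightarrow> Q \<nu>"
  shows "ereal \<nu> \<le> Sup (ereal ` {\<eta>. Q \<eta>}) \<longleftrightarrow> Q \<nu>"
proof
  assume "ereal \<nu> \<le> Sup (ereal ` {\<eta>. Q \<eta>})"
  then have "ereal c < Sup (ereal ` {\<eta>. Q \<eta>})"
    using assms(1) by (simp add: less_le_trans[of "ereal c" "ereal \<nu>"])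
  then obtain \<eta> where "Q \<eta>" "c < \<eta>" by (auto simp: less_Sup_iff)
  then show "Q \<nu>" by (rule assms(2))
qed (auto intro: Sup_upper)

lemma finite_weights: "finite {gamma A p a q | p a q. True}"
proof (rule finite_subset)
  let ?X = "(\<lambda>(p, a, q). gamma A p a q) ` ({..<nstates A} \<times> {..<nletters A} \<times> {..<nstates A})"
  show "{gamma A p a q | p a q. True} \<subseteq> insert 0 ?X"
  proof safe
    fix p a q assume "gamma A p a q \<notin> ?X"
    then have "\<not> (p < nstates A \<and> a < nletters A \<and> q < nstates A)" by force
    then show "gamma A p a q = 0" unfolding gamma_def by (rule if_not_P)
  qed
qed simp

lemma weight_seq_in_weights: "weight_seq A w r i \<in> {gamma A p a q | p a q. True}"
  by (auto simp: weight_seq_def)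

lemmas le_LimInf_weight_seq_iff = le_LimInf_iff[OF finite_weights weight_seq_in_weights]
lemmas le_LimSup_weight_seq_iff = le_LimSup_iff[OF finite_weights weight_seq_in_weights]

lemma le_L_pos_LimInf_iff:
  assumes "wf_pwa A" "w \<in> words A"
  shows "ereal \<nu> \<le> L_pos LimInf A w \<longleftrightarrow>
    0 < emeasure (run_measure A w) {r. \<exists>k. \<forall>i\<ge>k. \<nu> \<le> gamma A (r i) (w i) (r (Suc i))}"
proof -
  interpret pwa_word A w "\<lambda>p a q. \<nu> \<le> gamma A p a q" using assms by unfold_locales
  let ?Q = "\<lambda>\<eta>. 0 < emeasure M {r. \<exists>k. \<forall>i\<ge>k. \<eta> \<le> gamma A (r i) (w i) (r (Suc i))}"
  obtain c where c: "c < \<nu>" "\<And>p a q. gamma A p a q < \<nu> \<Longrightarrow> gamma A p a q \<le> c"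
    using finite_gap[OF finite_weights] by blast
  \<comment> \<open>A weight that is at least \<open>\<eta>\<close> exceeds \<open>c\<close> and
    hence is at least \<open>\<nu>\<close>.\<close>
  have Q: "?Q \<nu>" if "?Q \<eta>" "c < \<eta>" for \<eta>
  proof (rule less_le_trans[OF that(1) emeasure_mono])
    show "{r. \<exists>k. \<forall>i\<ge>k. \<eta> \<le> gamma A (r i) (w i) (r (Suc i))} \<subseteq> eventually_good"
      using c(2) that(2) by (smt (verit, best) Collect_mono)
  qed simp
  have "{r \<in> space run_space. ereal \<eta> \<le> LimInf (weight_seq A w r)}
      = {r. \<exists>k. \<forall>i\<ge>k. \<eta> \<le> gamma A (r i) (w i) (r (Suc i))}" for \<eta>
    unfolding le_LimInf_weight_seq_iff weight_seq_def by simp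
  then have "L_pos LimInf A w = Sup (ereal ` {\<eta>. ?Q \<eta>})" by (simp add: L_pos_def)
  also have "ereal \<nu> \<le> \<dots> \<longleftrightarrow> ?Q \<nu>" by (rule le_Sup_threshold_iff[OF c(1)]) (rule Q)
  finally show ?thesis .
qed

lemma le_L_as_LimSup_iff:
  assumes "wf_pwa A" "w \<in> words A"
  shows "ereal \<nu> \<le> L_as LimSup A w \<longleftrightarrow>
    \<not> 0 < emeasure (run_measure A w) {r. \<exists>k. \<forall>i\<ge>k. gamma A (r i) (w i) (r (Suc i)) < \<nu>}"
proof -
  interpret pwa_word A w "\<lambda>p a q. gamma A p a q < \<nu>" using assms by unfold_locales
  let ?G = "\<lambda>\<eta>. {r. \<exists>k. \<forall>i\<ge>k. gamma A (r i) (w i) (r (Suc i)) < \<eta>}"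
  let ?Q = "\<lambda>\<eta>. emeasure M (- ?G \<eta>) = 1"
  obtain c where c: "c < \<nu>" "\<And>p a q. gamma A p a q < \<nu> \<Longrightarrow> gamma A p a q \<le> c"
    using finite_gap[OF finite_weights] by blast
  have meas: "- ?G \<nu> \<in> sets M"
    using sets.compl_sets[of eventually_good M] by (simp add: Compl_eq_Diff_UNIV)
  have Q: "?Q \<nu>" if "?Q \<eta>" "c < \<eta>" for \<eta>
  proof (rule antisym)
    have "?G \<nu> \<subseteq> ?G \<eta>" using c(2) that(2) by (smt (verit, best) Collect_mono)
    then have "emeasure M (- ?G \<eta>) \<le> emeasure M (- ?G \<nu>)" by (intro emeasure_mono meas) blast
    then show "1 \<le> emeasure M (- ?G \<nu>)" using that(1) by simp
  qed (rule emeasure_le_1)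
  have "{r \<in> space run_space. ereal \<eta> \<le> LimSup (weight_seq A w r)} = - ?G \<eta>" for \<eta>
    unfolding le_LimSup_weight_seq_iff weight_seq_def by (simp add: Collect_neg_eq[symmetric])
  then have "L_as LimSup A w = Sup (ereal ` {\<eta>. ?Q \<eta>})" by (simp add: L_as_def)
  also have "ereal \<nu> \<le> \<dots> \<longleftrightarrow> ?Q \<nu>" by (rule le_Sup_threshold_iff[OF c(1)]) (rule Q)
  also have "\<dots> \<longleftrightarrow> \<not> 0 < emeasure M (?G \<nu>)"
    using prob_compl[of "?G \<nu>"] by (simp add: emeasure_eq_measure Compl_eq_Diff_UNIV zero_less_measure_iff)
  finally show ?thesis .
qed

section \<open>Safety as a bounded statement about codes\<close>

lemma reachably_safe_cong:
  assumes "\<And>p a q. 0 < delta A p a q \<Longrightarrow> good p a q \<longleftrightarrow> good' p a q"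
  shows "reachably_safe A good \<longleftrightarrow> reachably_safe A good'"
proof -
  have "safe_family A good W \<longleftrightarrow> safe_family A good' W" for W
    unfolding safe_family_def using assms by meson
  then show ?thesis by (simp add: reachably_safe_def)
qed

text \<open>The reachable states form the least closed set, so reachability quantifies only over
  subsets of a finite set.\<close>

lemma reach_iff_closed_sets:
  assumes "q < nstates A"
  shows "reach A q \<longleftrightarrow> (\<forall>R\<subseteq>{..<nstates A}. (\<forall>p<nstates A. 0 < rhoI A p \<longrightarrow> p \<in> R) \<longrightarrow>
    (\<forall>p<nstates A. p \<in> R \<longrightarrow> (\<forall>a<nletters A. \<forall>q<nstates A. 0 < delta A p a q \<longrightarrow> q \<in> R)) \<longrightarrow> q \<in> R)"
    (is "_ \<longleftrightarrow> ?closed")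
proof
  assume "reach A q"
  then show ?closed
  proof induction
    case (init q)
    then show ?case by (auto simp: rhoI_def split: if_splits)
  next
    case (step p a q)
    then show ?case using delta_pos_bounds[OF step.hyps(2)] by blast
  qed
next
  assume closed: ?closed
  have "{q. reach A q} \<subseteq> {..<nstates A}" using reach_less by blast
  moreover have "\<forall>p<nstates A. 0 < rhoI A p \<longrightarrow> p \<in> {q. reach A q}" using reach.init by blast
  moreover have "\<forall>p<nstates A. p \<in> {q. reach A q} \<longrightarrow>
      (\<forall>a<nletters A. \<forall>q<nstates A. 0 < delta A p a q \<longrightarrow> q \<in> {q. reach A q})"
    using reach.step by blast
  ultimately have "q \<in> {q. reach A q}" by (rule closed[THEN spec, THEN mp, THEN mp, THEN mp])
  then show "reach A q" by simp
qed

text \<open>Turns quantifiers over sets of states into bounded quantifiers over \<open>n\<close>-bit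
  numbers.\<close>

lemma set_decode_subset_iff: "set_decode x \<subseteq> {..<n} \<longleftrightarrow> x < 2 ^ n"
proof
  have "set_encode {..<n} = 2 ^ n - 1"
    unfolding set_encode_def using sum_power2[of n] by (simp add: lessThan_atLeast0)
  moreover assume "set_decode x \<subseteq> {..<n}"
  then have "x \<le> set_encode {..<n}" by (intro subset_decode_imp_le) simp
  ultimately show "x < 2 ^ n" by (simp add: le_diff_conv2 Suc_le_eq[symmetric])
next
  assume x: "x < 2 ^ n"
  show "set_decode x \<subseteq> {..<n}"
  proof
    fix i assume "i \<in> set_decode x"
    then have "0 < x div 2 ^ i" by (intro odd_pos) (simp add: set_decode_def)
    then have "2 ^ i \<le> x" by (simp add: div_greater_zero_iff)
    then have "(2::nat) ^ i < 2 ^ n" using x by (rule le_less_trans)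
    then show "i \<in> {..<n}" by simp
  qed
qed

lemma ex_set_decode: "(\<exists>x<2 ^ n. P (set_decode x)) \<longleftrightarrow> (\<exists>S\<subseteq>{..<n}. P S)"
  by (metis set_decode_subset_iff set_encode_inverse finite_subset finite_lessThan)

lemma all_set_decode: "(\<forall>x<2 ^ n. P (set_decode x)) \<longleftrightarrow> (\<forall>S\<subseteq>{..<n}. P S)"
  using ex_set_decode[of n "\<lambda>S. \<not> P S"] by blast

lemma inj_set_decode: "inj set_decode"
  by (rule inj_on_inverseI[of _ set_encode]) simp

lemma Pow_lessThan_eq: "Pow {..<n} = set_decode ` {..<2 ^ n}"
proof (intro subset_antisym subsetI)
  fix S assume "S \<in> Pow {..<n}"
  then have "S \<subseteq> {..<n}" "S = set_decode (set_encode S)"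
    using finite_subset[of S "{..<n}"] by simp_all
  then have "set_encode S < 2 ^ n" "S = set_decode (set_encode S)"
    using set_decode_subset_iff[of "set_encode S" n] by simp_all
  then show "S \<in> set_decode ` {..<2 ^ n}" by blast
qed (auto simp: set_decode_subset_iff[symmetric])

text \<open>A family is coded in two layers: the bits of a number are the codes of its members,
  which lie below \<open>2 ^ n\<close>.\<close>

lemma ex_set_decode_image:
  "(\<exists>x<2 ^ 2 ^ n. P (set_decode ` set_decode x)) \<longleftrightarrow> (\<exists>W\<subseteq>Pow {..<n}. P W)"
proof -
  have "(\<exists>x<2 ^ 2 ^ n. P (set_decode ` set_decode x)) \<longleftrightarrow> (\<exists>C\<subseteq>{..<2 ^ n}. P (set_decode ` C))"
    by (rule ex_set_decode)
  also have "\<dots> \<longleftrightarrow> (\<exists>W\<subseteq>set_decode ` {..<2 ^ n}. P W)"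
    by (metis image_mono subset_imageE)
  finally show ?thesis unfolding Pow_lessThan_eq .
qed

lemma set_decode_power2: "set_decode (2 ^ q) = {q}"
  using set_encode_inverse[of "{q}"] by (simp del: set_encode_inverse)

text \<open>Free variables \<open>0, \<dots>, 5\<close>: number of states, number of letters, initial distribution, transitions,
  weights, threshold. The bound variables are, in order, \<open>W S a S' p q\<close> and \<open>q R p a q'\<close>.\<close>
definition safeE :: "(pexp \<Rightarrow> pexp \<Rightarrow> pexp) \<Rightarrow> pexp" where
  "safeE g = BEx (Pow2E (Pow2E (Var 0)))
    (AndE
      (AllE (Pow2E (Var 1)) (ImpE (MemE (Var 0) (Var 1))
        (BEx (Var 3) (BEx (Pow2E (Var 3)) (AndE (MemE (Var 0) (Var 3))
          (AllE (Var 4) (ImpE (MemE (Var 0) (Var 3))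
            (AllE (Var 5) (ImpE (FstE (NthE (NthE (NthE (Var 9) (Var 1)) (Var 3)) (Var 0)))
              (AndE (g (NthE (NthE (NthE (Var 10) (Var 1)) (Var 3)) (Var 0)) (Var 11))
                (MemE (Var 0) (Var 2))))))))))))
      (BEx (Var 1) (AndE (MemE (Pow2E (Var 0)) (Var 1))
        (AllE (Pow2E (Var 2))
          (ImpE (AllE (Var 3) (ImpE (FstE (NthE (Var 6) (Var 0))) (MemE (Var 0) (Var 1))))
            (ImpE (AllE (Var 3) (ImpE (MemE (Var 0) (Var 1)) (AllE (Var 5) (AllE (Var 5)
                (ImpE (FstE (NthE (NthE (NthE (Var 9) (Var 2)) (Var 1)) (Var 0)))
                  (MemE (Var 0) (Var 3)))))))
              (MemE (Var 1) (Var 0))))))))"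

lemma ev_NthE3:
  assumes "ev c xs = enc_list (enc_list (enc_list e)) ys"
    and "ev i xs < length ys" "ev j xs < length (ys ! ev i xs)"
    and "ev k xs < length (ys ! ev i xs ! ev j xs)"
  shows "ev (NthE (NthE (NthE c i) j) k) xs = e (ys ! ev i xs ! ev j xs ! ev k xs)"
  using assms by (simp add: ev_NthE_enc_list[where e = "enc_list (enc_list e)"]
      ev_NthE_enc_list[where e = "enc_list e"] ev_NthE_enc_list[where e = e])

text \<open>\<open>g\<close> builds the test of a weight against the threshold, and \<open>G\<close>
  is its meaning.\<close>

lemma holds_safeE:
  assumes wf: "wf_pwa A"
    and g: "\<And>x y xs q r. ev x xs = enc_rat q \<Longrightarrow> ev y xs = enc_rat r \<Longrightarrow> holds (g x y) xs \<longleftrightarrow> G q r"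
  shows "holds (safeE g) [nstates A, nletters A, enc_list enc_rat (init A),
      enc_list (enc_list (enc_list enc_rat)) (trans A),
      enc_list (enc_list (enc_list enc_rat)) (wt A), enc_rat \<nu>]
    \<longleftrightarrow> reachably_safe A (\<lambda>p a q. G (wt A ! p ! a ! q) \<nu>)"
proof -
  let ?n = "nstates A" and ?m = "nletters A"
  let ?good = "\<lambda>p a q. G (wt A ! p ! a ! q) \<nu>"
  let ?D = set_decode
  have init: "holds (FstE (NthE c i)) xs \<longleftrightarrow> 0 < rhoI A (ev i xs)"
    if "ev c xs = enc_list enc_rat (init A)" "ev i xs < ?n" for c i xs
  proof -
    have len: "length (init A) = ?n" using wf by (simp add: wf_pwa_def distr_list_def)
    have "holds (FstE (NthE c i)) xs \<longleftrightarrow> init A ! ev i xs \<noteq> 0"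
      using that len by (intro holds_enc_rat_pos ev_NthE_enc_list) simp_all
    also have "\<dots> \<longleftrightarrow> rhoI A (ev i xs) \<noteq> 0" using that by (simp add: rhoI_def)
    finally show ?thesis using rhoI_nonneg[OF wf, of "ev i xs"] by auto
  qed
  have trans: "holds (FstE (NthE (NthE (NthE c i) j) k)) xs \<longleftrightarrow> 0 < delta A (ev i xs) (ev j xs) (ev k xs)"
    if "ev c xs = enc_list (enc_list (enc_list enc_rat)) (trans A)"
      "ev i xs < ?n" "ev j xs < ?m" "ev k xs < ?n" for c i j k xs
  proof -
    have "holds (FstE (NthE (NthE (NthE c i) j) k)) xs \<longleftrightarrow> trans A ! ev i xs ! ev j xs ! ev k xs \<noteq> 0"
      using that wf by (intro holds_enc_rat_pos ev_NthE3) (simp_all add: wf_pwa_def distr_list_def)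
    also have "\<dots> \<longleftrightarrow> delta A (ev i xs) (ev j xs) (ev k xs) \<noteq> 0" using that by (simp add: delta_def)
    finally show ?thesis using delta_nonneg[OF wf, of "ev i xs" "ev j xs" "ev k xs"] by auto
  qed
  have wt: "holds (g (NthE (NthE (NthE c i) j) k) t) xs \<longleftrightarrow> ?good (ev i xs) (ev j xs) (ev k xs)"
    if "ev c xs = enc_list (enc_list (enc_list enc_rat)) (wt A)" "ev t xs = enc_rat \<nu>"
      "ev i xs < ?n" "ev j xs < ?m" "ev k xs < ?n" for c i j k t xs
    using that wf by (intro g ev_NthE3) (simp_all add: wf_pwa_def)
  let ?reach = "\<lambda>q. \<forall>R<2 ^ ?n. (\<forall>p<?n. 0 < rhoI A p \<longrightarrow> p \<in> ?D R) \<longrightarrow>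
    (\<forall>p<?n. p \<in> ?D R \<longrightarrow> (\<forall>a<?m. \<forall>q<?n. 0 < delta A p a q \<longrightarrow> q \<in> ?D R)) \<longrightarrow> q \<in> ?D R"
  have reach: "?reach q \<longleftrightarrow> reach A q" if "q < ?n" for q
    unfolding reach_iff_closed_sets[OF that] by (rule all_set_decode)
  have "holds (safeE g) [?n, ?m, enc_list enc_rat (init A),
      enc_list (enc_list (enc_list enc_rat)) (trans A),
      enc_list (enc_list (enc_list enc_rat)) (wt A), enc_rat \<nu>] \<longleftrightarrow>
    (\<exists>W<2 ^ 2 ^ ?n. (\<forall>S<2 ^ ?n. S \<in> ?D W \<longrightarrow> (\<exists>a<?m. \<exists>S'<2 ^ ?n. S' \<in> ?D W \<and>
        (\<forall>p<?n. p \<in> ?D S \<longrightarrow> (\<forall>q<?n. 0 < delta A p a q \<longrightarrow> ?good p a q \<and> q \<in> ?D S')))) \<and>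
      (\<exists>q<?n. 2 ^ q \<in> ?D W \<and> ?reach q))"
    unfolding safeE_def by (simp add: init trans wt cong: conj_cong)
  \<comment> \<open>\<open>set_decode\<close> is injective, so a code is a member exactly when its
    decoded set is among the decoded members.\<close>
  also have "\<dots> \<longleftrightarrow>
    (\<exists>W<2 ^ 2 ^ ?n. (\<forall>S<2 ^ ?n. ?D S \<in> ?D ` ?D W \<longrightarrow> (\<exists>a<?m. \<exists>S'<2 ^ ?n. ?D S' \<in> ?D ` ?D W \<and>
        (\<forall>p<?n. p \<in> ?D S \<longrightarrow> (\<forall>q<?n. 0 < delta A p a q \<longrightarrow> ?good p a q \<and> q \<in> ?D S')))) \<and>
      (\<exists>q<?n. {q} \<in> ?D ` ?D W \<and> reach A q))"
    by (simp add: inj_image_mem_iff[OF inj_set_decode] set_decode_power2[symmetric] reach cong: conj_cong)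
  also have "\<dots> \<longleftrightarrow>
    (\<exists>W\<subseteq>Pow {..<?n}. (\<forall>S<2 ^ ?n. ?D S \<in> W \<longrightarrow> (\<exists>a<?m. \<exists>S'<2 ^ ?n. ?D S' \<in> W \<and>
        (\<forall>p<?n. p \<in> ?D S \<longrightarrow> (\<forall>q<?n. 0 < delta A p a q \<longrightarrow> ?good p a q \<and> q \<in> ?D S')))) \<and>
      (\<exists>q<?n. {q} \<in> W \<and> reach A q))"
    by (rule ex_set_decode_image)
  also have "\<dots> \<longleftrightarrow>
    (\<exists>W\<subseteq>Pow {..<?n}. (\<forall>S\<subseteq>{..<?n}. S \<in> W \<longrightarrow> (\<exists>a<?m. \<exists>S'\<subseteq>{..<?n}. S' \<in> W \<and>
        (\<forall>p<?n. p \<in> S \<longrightarrow> (\<forall>q<?n. 0 < delta A p a q \<longrightarrow> ?good p a q \<and> q \<in> S')))) \<and>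
      (\<exists>q<?n. {q} \<in> W \<and> reach A q))"
    unfolding all_set_decode[symmetric] ex_set_decode[symmetric] ..
  also have "\<dots> \<longleftrightarrow> reachably_safe A ?good"
  proof -
    have "(\<forall>S\<subseteq>{..<?n}. S \<in> W \<longrightarrow> (\<exists>a<?m. \<exists>S'\<subseteq>{..<?n}. S' \<in> W \<and>
        (\<forall>p<?n. p \<in> S \<longrightarrow> (\<forall>q<?n. 0 < delta A p a q \<longrightarrow> ?good p a q \<and> q \<in> S'))))
      \<longleftrightarrow> (\<forall>S\<in>W. \<exists>a<?m. \<exists>S'\<in>W. \<forall>p\<in>S. \<forall>q. 0 < delta A p a q \<longrightarrow> ?good p a q \<and> q \<in> S')"
      if W: "W \<subseteq> Pow {..<?n}" for W
    proof -
      have sub: "S \<subseteq> {..<?n}" if "S \<in> W" for S using W that by blast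
      have all: "(\<forall>S\<subseteq>{..<?n}. S \<in> W \<longrightarrow> X S) \<longleftrightarrow> (\<forall>S\<in>W. X S)" for X using sub by blast
      have ex: "(\<exists>S\<subseteq>{..<?n}. S \<in> W \<and> X S) \<longleftrightarrow> (\<exists>S\<in>W. X S)" for X using sub by blast
      have post: "(\<forall>p<?n. p \<in> S \<longrightarrow> (\<forall>q<?n. 0 < delta A p a q \<longrightarrow> ?good p a q \<and> q \<in> S'))
        \<longleftrightarrow> (\<forall>p\<in>S. \<forall>q. 0 < delta A p a q \<longrightarrow> ?good p a q \<and> q \<in> S')" for S a S'
        using delta_pos_bounds by blast
      show ?thesis unfolding post all ex ..
    qed
    moreover have "(\<exists>q<?n. {q} \<in> W \<and> reach A q) \<longleftrightarrow> (\<exists>q. reach A q \<and> {q} \<in> W)" for W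
      using reach_less by blast
    ultimately show ?thesis
      unfolding reachably_safe_def safe_family_def by (simp add: conj_assoc cong: conj_cong)
  qed
  finally show ?thesis .
qed

fun numE :: "nat \<Rightarrow> pexp" where
  "numE 0 = Nul"
| "numE (Suc k) = Inc (numE k)"

lemma ev_numE [simp]: "ev (numE k) xs = k"
  by (induction k) auto

text \<open>Unpacks an instance into the six variables of \<open>safeE\<close>.\<close>

definition instE :: "(pexp \<Rightarrow> pexp \<Rightarrow> pexp) \<Rightarrow> pexp" where
  "instE g = Call (safeE g) (map (\<lambda>k. NthE (FstE (Var 0)) (numE k)) [0..<5] @ [SndE (Var 0)])"

lemma holds_instE:
  assumes "wf_pwa A"
    and "\<And>x y xs q r. ev x xs = enc_rat q \<Longrightarrow> ev y xs = enc_rat r \<Longrightarrow> holds (g x y) xs \<longleftrightarrow> G q r"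
  shows "holds (instE g) [enc_inst (A, \<nu>)] \<longleftrightarrow> reachably_safe A (\<lambda>p a q. G (wt A ! p ! a ! q) \<nu>)"
proof -
  let ?xs = "[enc_inst (A, \<nu>)]"
  let ?ys = "[nstates A, nletters A, enc_list enc_rat (init A),
      enc_list (enc_list (enc_list enc_rat)) (trans A), enc_list (enc_list (enc_list enc_rat)) (wt A)]"
  have 0: "ev (Var 0) ?xs = prod_encode (enc_pwa A, enc_rat \<nu>)" by (simp add: enc_inst_def)
  have "ev (NthE (FstE (Var 0)) (numE k)) ?xs = ?ys ! k" if "k < 5" for k
    using ev_NthE[of "FstE (Var 0)" ?xs ?ys "numE k"] ev_FstE[OF 0] that by (simp add: enc_pwa_def)
  then have "map (\<lambda>e. ev e ?xs) (map (\<lambda>k. NthE (FstE (Var 0)) (numE k)) [0..<5]) = map ((!) ?ys) [0..<5]"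
    by simp
  also have "\<dots> = ?ys" by (simp add: upt_rec)
  finally show ?thesis
    using holds_safeE[OF assms, where \<nu> = \<nu>] ev_SndE[OF 0] by (simp add: instE_def)
qed

theorem theorem9:
  shows "decidable_on enc_inst (\<lambda>(A, \<nu>). wf_pwa A)
           (\<lambda>(A, \<nu>). \<exists>w\<in>words A. L_pos LimInf A w \<ge> ereal (real_of_rat \<nu>))
       \<and> decidable_on enc_inst (\<lambda>(A, \<nu>). wf_pwa A)
           (\<lambda>(A, \<nu>). \<forall>w\<in>words A. L_as LimSup A w \<ge> ereal (real_of_rat \<nu>))"
proof
  have gamma: "gamma A p a q = real_of_rat (wt A ! p ! a ! q)" if "0 < delta A p a q" for A p a q
    using delta_pos_bounds[OF that] by (simp add: gamma_def)
  show "decidable_on enc_inst (\<lambda>(A, \<nu>). wf_pwa A)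
      (\<lambda>(A, \<nu>). \<exists>w\<in>words A. L_pos LimInf A w \<ge> ereal (real_of_rat \<nu>))"
  proof (rule decidable_onI, clarify)
    fix A \<nu> assume wf: "wf_pwa A"
    \<comment> \<open>The test receives the weight first and the threshold second, hence the swapped
      arguments.\<close>
    have "holds (instE (\<lambda>x y. LeRatE y x)) [enc_inst (A, \<nu>)] \<longleftrightarrow>
        reachably_safe A (\<lambda>p a q. \<nu> \<le> wt A ! p ! a ! q)"
      by (rule holds_instE[OF wf]) (rule holds_LeRatE)
    also have "\<dots> \<longleftrightarrow> reachably_safe A (\<lambda>p a q. real_of_rat \<nu> \<le> gamma A p a q)"
      by (rule reachably_safe_cong) (simp add: gamma of_rat_less_eq)
    also have "\<dots> \<longleftrightarrow> (\<exists>w\<in>words A. L_pos LimInf A w \<ge> ereal (real_of_rat \<nu>))"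
      unfolding ex_eventually_good_iff_reachably_safe[OF wf, symmetric]
      by (simp add: le_L_pos_LimInf_iff[OF wf])
    finally show "holds (instE (\<lambda>x y. LeRatE y x)) [enc_inst (A, \<nu>)] \<longleftrightarrow>
        (\<exists>w\<in>words A. L_pos LimInf A w \<ge> ereal (real_of_rat \<nu>))" .
  qed
  show "decidable_on enc_inst (\<lambda>(A, \<nu>). wf_pwa A)
      (\<lambda>(A, \<nu>). \<forall>w\<in>words A. L_as LimSup A w \<ge> ereal (real_of_rat \<nu>))"
  proof (rule decidable_onI, clarify)
    fix A \<nu> assume wf: "wf_pwa A"
    \<comment> \<open>Universality fails exactly when some word keeps the weights eventually below
      \<open>\<nu>\<close> with positive probability; this failure is decided and then
      negated.\<close>
    let ?e = "instE (\<lambda>x y. NotE (LeRatE y x))"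
    have "holds ?e [enc_inst (A, \<nu>)] \<longleftrightarrow> reachably_safe A (\<lambda>p a q. wt A ! p ! a ! q < \<nu>)"
      by (rule holds_instE[OF wf]) (simp add: holds_LeRatE not_le)
    also have "\<dots> \<longleftrightarrow> reachably_safe A (\<lambda>p a q. gamma A p a q < real_of_rat \<nu>)"
      by (rule reachably_safe_cong) (simp add: gamma of_rat_less)
    also have "\<dots> \<longleftrightarrow> \<not> (\<forall>w\<in>words A. L_as LimSup A w \<ge> ereal (real_of_rat \<nu>))"
      unfolding ex_eventually_good_iff_reachably_safe[OF wf, symmetric]
      by (simp add: le_L_as_LimSup_iff[OF wf] zero_less_iff_neq_zero)
    finally show "holds (NotE ?e) [enc_inst (A, \<nu>)] \<longleftrightarrow>
        (\<forall>w\<in>words A. L_as LimSup A w \<ge> ereal (real_of_rat \<nu>))" by simp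
  qed
qed

end
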